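(* Assume the Undirected $k$-pairs Conjecture (stated in the context) holds. Then any oblivious randomized external memory algorithm for the permutation problem (defined in the context), having error probability at most $1/3$ on every input, must make an expected $$\Omega\Big(\frac{n}{B}\cdot\lg_{2M/B}\frac{n}{B}\Big)$$ I/Os.
   Context: External memory model: internal memory of $M$ words of $w$ bits ($m=Mw$ bits), unbounded disk partitioned into blocks of $B$ words ($b=Bw$ bits); an I/O reads or writes one block; cost is number of I/Os; computation in memory is free and unrestricted. An algorithm is oblivious if its memory access pattern is fixed and independent of the input. Permutation problem: input is a permutation $\pi$ of $\{1,\dots,n\}$ and bit strings $d_1,\dots,d_n\in\{0,1\}^w$, with $w\ge\lg n$, given as an array $A$ whose $i$-th entry stores $(\pi(i),d_i)$, packed $b/(w+\lg n)$ entries per block. There is an initially empty output array $C$ of $n$ words of $w$ bits, packed $b/w$ per block. The goal is to store $d_i$ in $C[\pi(i)]$ for all $i$. Undirected $k$-pairs Conjecture (Li and Li). An instance is a directed acyclic graph $G=(V,E)$ with capacities $c(e)>0$ and $k$ source–sink pairs $(s_i,t_i)$, each with demand $1$. Each source $s_i$ receives a message $A_i$ drawn uniformly and independently from a finite set. A network coding solution assigns to every edge $e=(u,v)$ an alphabet and a function giving the message on $e$ from the messages on the in-edges of $u$, and to every sink $t_i$ a decoding function of the messages on its in-edges, which must output $A_i$ for all inputs. It achieves rate $r$ if $H(A_i)\ge r$ for all $i$ and $H(A_e)\le c(e)$ for every edge $e$, where $A_e$ is the random message on $e$ and $H$ is binary Shannon entropy. A multicommodity flow in the undirected version $G'$ of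 $G$ consists of fractional flows $f_i$ supported on edges, satisfying flow conservation and sending one unit from $s_i$ to $t_i$; it achieves rate $r$ if $r\sum_i (f_i(u,v)+f_i(v,u))\le c(e)$ for every edge $e=\{u,v\}$. The conjecture states: for every such instance, the achievable network coding rate in $G$ is at most the achievable multicommodity flow rate in $G'$. *)

theory Defs
  imports "HOL-Probability.Probability" "HOL-Combinatorics.Permutations"
begin

section \<open>The undirected k-pairs conjecture\<close>

text \<open>
  Instances are finite, so vertices are taken to be natural numbers; likewise a message set is
  finite and only finitely many symbols are ever sent over an edge, so messages and edge
  alphabets are sets of natural numbers.  Pairs are indexed by \<open>{..<pairs G}\<close>.
\<close>

record kpairs =
  verts :: "nat set"
  edges :: "(nat \<times> nat) set"
  capacity :: "nat \<times> nat \<Rightarrow> real"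
  pairs :: nat
  source :: "nat \<Rightarrow> nat"
  sink :: "nat \<Rightarrow> nat"

definition kpairs_instance :: "kpairs \<Rightarrow> bool" where
  "kpairs_instance G \<longleftrightarrow>
     finite (verts G) \<and> edges G \<subseteq> verts G \<times> verts G \<and> acyclic (edges G) \<and>
     (\<forall>e\<in>edges G. 0 < capacity G e) \<and>
     (\<forall>i<pairs G. source G i \<in> verts G \<and> sink G i \<in> verts G \<and> source G i \<noteq> sink G i)"

definition in_edges :: "kpairs \<Rightarrow> nat \<Rightarrow> (nat \<times> nat) set" where
  "in_edges G v = {e \<in> edges G. snd e = v}"

definition sources_at :: "kpairs \<Rightarrow> nat \<Rightarrow> nat set" where
  "sources_at G v = {i. i < pairs G \<and> source G i = v}"

text \<open>
  A message received by a source is treated like a message on an additional in-edge of that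
  source: a node sees the messages of the sources located there together with the messages on
  its in-edges.
\<close>

definition inputs_at ::
    "kpairs \<Rightarrow> nat \<Rightarrow> (nat \<Rightarrow> nat) \<Rightarrow> (nat \<times> nat \<Rightarrow> nat) \<Rightarrow> (nat \<Rightarrow> nat) \<times> (nat \<times> nat \<Rightarrow> nat)" where
  "inputs_at G v A X = (restrict A (sources_at G v), restrict X (in_edges G v))"

text \<open>
  \<open>S i\<close> is the message set of source \<open>i\<close>, \<open>alph e\<close> the alphabet of edge \<open>e\<close>, \<open>enc e\<close> the function
  of edge \<open>e\<close>, \<open>dec i\<close> the decoding function of sink \<open>i\<close>, and \<open>msg A e\<close> the message on edge \<open>e\<close>
  when the sources receive \<open>A\<close>.  By acyclicity the equation for \<open>msg\<close> determines \<open>msg A\<close> on the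
  edges.
\<close>

definition network_coding_solution ::
    "kpairs \<Rightarrow> (nat \<Rightarrow> nat set) \<Rightarrow> (nat \<times> nat \<Rightarrow> nat set) \<Rightarrow>
     (nat \<times> nat \<Rightarrow> (nat \<Rightarrow> nat) \<times> (nat \<times> nat \<Rightarrow> nat) \<Rightarrow> nat) \<Rightarrow>
     (nat \<Rightarrow> (nat \<Rightarrow> nat) \<times> (nat \<times> nat \<Rightarrow> nat) \<Rightarrow> nat) \<Rightarrow>
     ((nat \<Rightarrow> nat) \<Rightarrow> nat \<times> nat \<Rightarrow> nat) \<Rightarrow> bool" where
  "network_coding_solution G S alph enc dec msg \<longleftrightarrow>
     (\<forall>i<pairs G. finite (S i) \<and> S i \<noteq> {}) \<and>
     (\<forall>e\<in>edges G.
        enc e \<in> (PiE (sources_at G (fst e)) S \<times> PiE (in_edges G (fst e)) alph) \<rightarrow> alph e) \<and>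
     (\<forall>A \<in> PiE {..<pairs G} S.
        (\<forall>e\<in>edges G. msg A e = enc e (inputs_at G (fst e) A (msg A))) \<and>
        (\<forall>i<pairs G. dec i (inputs_at G (sink G i) A (msg A)) = A i))"

definition source_space :: "kpairs \<Rightarrow> (nat \<Rightarrow> nat set) \<Rightarrow> (nat \<Rightarrow> nat) measure" where
  "source_space G S = uniform_count_measure (PiE {..<pairs G} S)"

definition shannon_entropy :: "'a measure \<Rightarrow> ('a \<Rightarrow> 'b) \<Rightarrow> real" where
  "shannon_entropy P X = prob_space.entropy P 2 (count_space (X ` space P)) X"

definition coding_rate :: "kpairs \<Rightarrow> real \<Rightarrow> bool" where
  "coding_rate G r \<longleftrightarrow> (\<exists>S alph enc dec msg.
     network_coding_solution G S alph enc dec msg \<and>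
     (\<forall>i<pairs G. r \<le> shannon_entropy (source_space G S) (\<lambda>A. A i)) \<and>
     (\<forall>e\<in>edges G. shannon_entropy (source_space G S) (\<lambda>A. msg A e) \<le> capacity G e))"

definition multicommodity_flow :: "kpairs \<Rightarrow> (nat \<Rightarrow> nat \<Rightarrow> nat \<Rightarrow> real) \<Rightarrow> bool" where
  "multicommodity_flow G f \<longleftrightarrow> (\<forall>i<pairs G.
     (\<forall>u v. 0 \<le> f i u v) \<and>
     (\<forall>u v. (u, v) \<notin> edges G \<union> (edges G)\<inverse> \<longrightarrow> f i u v = 0) \<and>
     (\<forall>v \<in> verts G - {source G i, sink G i}.
        (\<Sum>u\<in>verts G. f i u v) = (\<Sum>u\<in>verts G. f i v u)) \<and>
     (\<Sum>u\<in>verts G. f i (source G i) u) - (\<Sum>u\<in>verts G. f i u (source G i)) = 1 \<and>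
     (\<Sum>u\<in>verts G. f i u (sink G i)) - (\<Sum>u\<in>verts G. f i (sink G i) u) = 1)"

definition flow_rate :: "kpairs \<Rightarrow> real \<Rightarrow> bool" where
  "flow_rate G r \<longleftrightarrow> (\<exists>f. multicommodity_flow G f \<and>
     (\<forall>(u, v)\<in>edges G. r * (\<Sum>i<pairs G. f i u v + f i v u) \<le> capacity G (u, v)))"

text \<open>
  Only positive rates are compared: rate 0 is achieved by coding with singleton message sets
  even if some sink cannot be reached from its source, in which case no unit flow exists (and
  the flow rate is 0 by convention).
\<close>

definition undirected_k_pairs_conjecture :: bool where
  "undirected_k_pairs_conjecture \<longleftrightarrow>
     (\<forall>G r. kpairs_instance G \<longrightarrow> 0 < r \<longrightarrow> coding_rate G r \<longrightarrow> flow_rate G r)"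


section \<open>External memory algorithms\<close>

type_synonym bits = "bool list"

type_synonym disk = "nat \<Rightarrow> bits"

datatype io = Read nat | Write nat

text \<open>
  \<open>ReadBlock a g\<close> reads the block at address \<open>a\<close> and replaces the memory contents by \<open>g\<close> applied
  to the block read (\<open>g\<close> may depend on the old memory contents); \<open>WriteBlock a x s\<close> writes \<open>x\<close> to
  address \<open>a\<close> and continues with memory contents \<open>s\<close>.  All computation between two I/Os is
  subsumed in the choice of the next action, which is an arbitrary function of the number of
  I/Os done so far and of the memory contents.
\<close>

datatype action = Halt | ReadBlock nat "bits \<Rightarrow> bits" | WriteBlock nat bits bits

record em_alg =
  init_mem :: bits
  next_action :: "nat \<Rightarrow> bits \<Rightarrow> action"

text \<open>Memory of \<open>m\<close> bits and blocks of \<open>b\<close> bits.\<close>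

definition em_algorithm :: "nat \<Rightarrow> nat \<Rightarrow> em_alg \<Rightarrow> bool" where
  "em_algorithm m b A \<longleftrightarrow> length (init_mem A) = m \<and>
     (\<forall>\<tau> s. length s = m \<longrightarrow>
        (case next_action A \<tau> s of
           Halt \<Rightarrow> True
         | ReadBlock a g \<Rightarrow> \<forall>x. length x = b \<longrightarrow> length (g x) = m
         | WriteBlock a x s' \<Rightarrow> length x = b \<and> length s' = m))"

text \<open>The memory component of a state is \<open>None\<close> once the algorithm has halted.\<close>

fun em_step :: "em_alg \<Rightarrow> nat \<Rightarrow> bits option \<times> disk \<Rightarrow> bits option \<times> disk" where
  "em_step A \<tau> (None, D) = (None, D)"
| "em_step A \<tau> (Some s, D) =
     (case next_action A \<tau> s of
        Halt \<Rightarrow> (None, D)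
      | ReadBlock a g \<Rightarrow> (Some (g (D a)), D)
      | WriteBlock a x s' \<Rightarrow> (Some s', D(a := x)))"

primrec em_run :: "em_alg \<Rightarrow> disk \<Rightarrow> nat \<Rightarrow> bits option \<times> disk" where
  "em_run A D 0 = (Some (init_mem A), D)"
| "em_run A D (Suc \<tau>) = em_step A \<tau> (em_run A D \<tau>)"

text \<open>The sequence of I/Os performed from initial disk \<open>D\<close>; it is \<open>None\<close> from halting on.\<close>

definition access_pattern :: "em_alg \<Rightarrow> disk \<Rightarrow> nat \<Rightarrow> io option" where
  "access_pattern A D \<tau> =
     (case fst (em_run A D \<tau>) of
        None \<Rightarrow> None
      | Some s \<Rightarrow>
          (case next_action A \<tau> s of
             Halt \<Rightarrow> None
           | ReadBlock a g \<Rightarrow> Some (Read a)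
           | WriteBlock a x s' \<Rightarrow> Some (Write a)))"

text \<open>The number of I/Os, infinite if the algorithm does not halt.\<close>

definition io_count :: "em_alg \<Rightarrow> disk \<Rightarrow> ennreal" where
  "io_count A D = emeasure (count_space UNIV) {\<tau>. access_pattern A D \<tau> \<noteq> None}"

definition halts_with :: "em_alg \<Rightarrow> disk \<Rightarrow> disk \<Rightarrow> bool" where
  "halts_with A D D' \<longleftrightarrow> (\<exists>\<tau>. em_run A D \<tau> = (None, D'))"

definition oblivious_on :: "disk set \<Rightarrow> em_alg \<Rightarrow> bool" where
  "oblivious_on I A \<longleftrightarrow> (\<forall>D\<in>I. \<forall>D'\<in>I. access_pattern A D = access_pattern A D')"


section \<open>The permutation problem\<close>

definition valid_input :: "nat \<Rightarrow> nat \<Rightarrow> (nat \<Rightarrow> nat) \<Rightarrow> (nat \<Rightarrow> bits) \<Rightarrow> bool" where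
  "valid_input n w \<pi> d \<longleftrightarrow> \<pi> permutes {1..n} \<and> (\<forall>i\<in>{1..n}. length (d i) = w)"

definition lg_ceil :: "nat \<Rightarrow> nat" where
  "lg_ceil n = nat \<lceil>log 2 (real n)\<rceil>"

definition binary :: "nat \<Rightarrow> nat \<Rightarrow> bits" where
  "binary l x = map (bit x) [0..<l]"

text \<open>
  In the input array the values \<open>\<pi> i \<in> {1..n}\<close> are stored as \<open>\<pi> i - 1\<close> in binary.
\<close>

definition input_bits :: "nat \<Rightarrow> nat \<Rightarrow> (nat \<Rightarrow> nat) \<Rightarrow> (nat \<Rightarrow> bits) \<Rightarrow> bits" where
  "input_bits n w \<pi> d = concat (map (\<lambda>i. binary (lg_ceil n) (\<pi> i - 1) @ d i) [1..<Suc n])"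

definition block_of :: "nat \<Rightarrow> bits \<Rightarrow> nat \<Rightarrow> bits" where
  "block_of b xs a = map (\<lambda>j. a * b + j < length xs \<and> xs ! (a * b + j)) [0..<b]"

text \<open>
  The entries are packed contiguously from address 0 on, so that there are \<open>b / (w + lg n)\<close> entries
  per block also if this is not an integer (in particular if it is below 1, as for \<open>B = 1\<close>).
  The output array \<open>C\<close> occupies the blocks following the input array.  It is initially empty, i.e. zero, as is
  the rest of the disk.
\<close>

definition input_disk :: "nat \<Rightarrow> nat \<Rightarrow> nat \<Rightarrow> (nat \<Rightarrow> nat) \<Rightarrow> (nat \<Rightarrow> bits) \<Rightarrow> disk" where
  "input_disk n w B \<pi> d = block_of (B * w) (input_bits n w \<pi> d)"

definition output_base :: "nat \<Rightarrow> nat \<Rightarrow> nat \<Rightarrow> nat" where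
  "output_base n w B = nat \<lceil>real (n * (w + lg_ceil n)) / real (B * w)\<rceil>"

text \<open>The word \<open>C[j]\<close> for \<open>j \<in> {1..n}\<close>.\<close>

definition output_word :: "nat \<Rightarrow> nat \<Rightarrow> nat \<Rightarrow> disk \<Rightarrow> nat \<Rightarrow> bits" where
  "output_word n w B D j =
     take w (drop ((j - 1) mod B * w) (D (output_base n w B + (j - 1) div B)))"

definition permutes_correctly ::
    "nat \<Rightarrow> nat \<Rightarrow> nat \<Rightarrow> (nat \<Rightarrow> nat) \<Rightarrow> (nat \<Rightarrow> bits) \<Rightarrow> em_alg \<Rightarrow> bool" where
  "permutes_correctly n w B \<pi> d A \<longleftrightarrow>
     (\<exists>D. halts_with A (input_disk n w B \<pi> d) D \<and> (\<forall>i\<in>{1..n}. output_word n w B D (\<pi> i) = d i))"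

definition permutation_inputs :: "nat \<Rightarrow> nat \<Rightarrow> nat \<Rightarrow> disk set" where
  "permutation_inputs n w B = {input_disk n w B \<pi> d |\<pi> d. valid_input n w \<pi> d}"

text \<open>
  A randomized algorithm is a probability distribution \<open>R\<close> over deterministic algorithms, i.e. the
  random choices are made in advance and are not charged; it is oblivious if, once the random
  choices are fixed, the access pattern does not depend on the input.
\<close>

definition oblivious_randomized_permutation_alg ::
    "nat \<Rightarrow> nat \<Rightarrow> nat \<Rightarrow> nat \<Rightarrow> real \<Rightarrow> em_alg measure \<Rightarrow> bool" where
  "oblivious_randomized_permutation_alg n w B M \<epsilon> R \<longleftrightarrow>
     prob_space R \<and>
     (\<forall>A\<in>space R. em_algorithm (M * w) (B * w) A \<and> oblivious_on (permutation_inputs n w B) A) \<and>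
     (\<forall>\<pi> d. valid_input n w \<pi> d \<longrightarrow>
        (\<lambda>A. io_count A (input_disk n w B \<pi> d)) \<in> borel_measurable R \<and>
        {A \<in> space R. \<not> permutes_correctly n w B \<pi> d A} \<in> sets R \<and>
        measure R {A \<in> space R. \<not> permutes_correctly n w B \<pi> d A} \<le> \<epsilon>)"

end

(*
  Fix the random choices and a permutation pi. Cutting the computation into epochs of M div B I/Os
  turns an oblivious algorithm into a network: in each epoch a memory node reads every accessed
  block once and writes it back once, so every node has O(M/B) neighbours and the total capacity
  is O(t B w) for t I/Os. Hence most sinks of a typical pi are at distance at least
  h = Omega(log_{2M/B} (n/B)) from their sources, and a flow of rate w uses capacity about n w h.

  The algorithm is wrong on a constant fraction of the data. To get a zero-error code, the sources
  send their words to a coordinator, which replaces the data vector by a nearest one on which the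
  algorithm succeeds. By concentration of measure only O(sqrt n) words change on average, so the
  corrections sent to encoders and sinks have small entropy. The coordinator is no shortcut:
  the k-pairs bound is used in its dual form (rate times sum of distances is at most the sum of
  capacity times length), with length h/2 for the edges at the coordinator. Paths through it still
  have length h, while its in-edges cost only n w h/2.
*)
theory Submission
  imports Defs
begin

section \<open>Entropy and the dual of the flow problem\<close>

text \<open>The conjecture compares flows only with codes that decode every input, from uniform and
  independent sources. Conditioning on the inputs that the algorithm solves would destroy the
  independence. Replacing the data instead keeps every input legal, and the price is only entropy on
  the correction edges.

  The epoch length balances two effects. An epoch passes on \<open>M * w\<close> bits of memory, so
  epochs of \<open>M div B\<close> I/Os pass on about \<open>t * B * w\<close> bits in all, the same
  order as the block traffic. Longer epochs would raise the degree of the graph, which governs the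
  base of the logarithm; shorter ones would let the memory traffic dominate.

  The network bound has error terms of order \<open>n * w\<close> that do not grow with the
  distance, so it says nothing while the logarithm is bounded. That range needs a separate argument:
  a run that solves more than half of the data for some permutation touches every output block, so
  \<open>n \<le> B * t\<close>. Solving \<open>5 / 9\<close> of all pairs of a permutation and data
  serves both arguments.\<close>

lemma shannon_entropy_uniform:
  assumes "finite \<Omega>" "\<Omega> \<noteq> {}"
  shows "shannon_entropy (uniform_count_measure \<Omega>) X =
    (\<Sum>y\<in>X ` \<Omega>. - (real (card {a \<in> \<Omega>. X a = y}) / card \<Omega> *
       log 2 (real (card {a \<in> \<Omega>. X a = y}) / card \<Omega>)))"
proof -
  let ?P = "uniform_count_measure \<Omega>"
  let ?p = "\<lambda>y. real (card {a \<in> \<Omega>. X a = y}) / card \<Omega>"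
  interpret prob_space ?P using assms by (rule prob_space_uniform_count_measure)
  interpret information_space ?P 2 by unfold_locales simp
  have sf: "simple_function ?P X"
    unfolding simple_function_def
    by (auto simp: space_uniform_count_measure sets_uniform_count_measure assms)
  have m: "measure ?P (X -` {y} \<inter> space ?P) = ?p y" for y
  proof -
    have "X -` {y} \<inter> space ?P = {a \<in> \<Omega>. X a = y}"
      by (auto simp: space_uniform_count_measure)
    then show ?thesis by (simp add: measure_uniform_count_measure assms)
  qed
  have "simple_distributed ?P X ?p"
    by (rule simple_distributedI[OF sf]) (auto simp: m)
  from entropy_simple_distributed[OF this] show ?thesis
    unfolding shannon_entropy_def space_uniform_count_measure by (simp add: sum_negf)
qed

text \<open>Gibbs' inequality, from \<open>ln z \<le> z - 1\<close>, with \<open>q\<close> allowed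
  to be a subprobability. Bounding an entropy now means choosing a suitable \<open>q\<close>, as one
  would choose a code.\<close>

lemma shannon_entropy_le_cross_entropy:
  assumes fin: "finite \<Omega>" "\<Omega> \<noteq> {}"
    and q: "\<And>y. y \<in> X ` \<Omega> \<Longrightarrow> 0 < q y" "(\<Sum>y\<in>X ` \<Omega>. q y) \<le> 1"
  shows "shannon_entropy (uniform_count_measure \<Omega>) X \<le> (\<Sum>a\<in>\<Omega>. - log 2 (q (X a))) / card \<Omega>"
proof -
  let ?p = "\<lambda>y. real (card {a \<in> \<Omega>. X a = y}) / card \<Omega>"
  have N: "card \<Omega> > 0" using fin by (simp add: card_gt_0_iff)
  have fib: "(\<Sum>y\<in>X ` \<Omega>. \<Sum>a\<in>{a \<in> \<Omega>. X a = y}. g (X a)) = (\<Sum>a\<in>\<Omega>. g (X a))" for g :: "'b \<Rightarrow> real"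
    by (rule sum.group) (auto simp: fin)
  have cr: "(\<Sum>y\<in>X ` \<Omega>. ?p y * g y) = (\<Sum>a\<in>\<Omega>. g (X a)) / card \<Omega>" for g :: "'b \<Rightarrow> real"
    unfolding fib[symmetric] by (simp add: sum_divide_distrib)
  have p1: "(\<Sum>y\<in>X ` \<Omega>. ?p y) = 1"
    using cr[of "\<lambda>_. 1"] N by simp
  have pt: "- (?p y * log 2 (?p y)) \<le> ?p y * (- log 2 (q y)) + (q y - ?p y) / ln 2"
    if y: "y \<in> X ` \<Omega>" for y
  proof -
    have "card {a \<in> \<Omega>. X a = y} > 0" using y fin by (auto simp: card_gt_0_iff)
    then obtain p where p: "?p y = p" and pp: "p > 0" using N by simp
    have "ln (q y / p) \<le> q y / p - 1" by (intro ln_le_minus_one divide_pos_pos pp q(1)[OF y])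
    then have "p * (ln (q y) - ln p) \<le> p * (q y / p - 1)"
      using pp q(1)[OF y] by (intro mult_left_mono) (simp_all add: ln_div)
    also have "\<dots> = q y - p" using pp by (simp add: field_simps)
    finally have "p * (ln (q y) - ln p) / ln 2 \<le> (q y - p) / ln 2"
      by (intro divide_right_mono) auto
    then show ?thesis unfolding p by (simp add: log_def field_simps)
  qed
  have "shannon_entropy (uniform_count_measure \<Omega>) X \<le>
      (\<Sum>y\<in>X ` \<Omega>. ?p y * (- log 2 (q y)) + (q y - ?p y) / ln 2)"
    unfolding shannon_entropy_uniform[OF fin] by (intro sum_mono pt)
  also have "\<dots> = (\<Sum>a\<in>\<Omega>. - log 2 (q (X a))) / card \<Omega> + ((\<Sum>y\<in>X ` \<Omega>. q y) - 1) / ln 2"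
    by (simp only: sum.distrib cr sum_divide_distrib[symmetric] sum_subtractf
        p1[folded sum_divide_distrib])
  also have "\<dots> \<le> (\<Sum>a\<in>\<Omega>. - log 2 (q (X a))) / card \<Omega>"
    using q(2) by (simp add: divide_nonpos_pos)
  finally show ?thesis .
qed

lemma shannon_entropy_le_log_card:
  assumes "finite \<Omega>" "\<Omega> \<noteq> {}" "X ` \<Omega> \<subseteq> Y" "finite Y"
  shows "shannon_entropy (uniform_count_measure \<Omega>) X \<le> log 2 (card Y)"
proof -
  have c: "card Y > 0" using assms by (auto simp: card_gt_0_iff)
  have "shannon_entropy (uniform_count_measure \<Omega>) X \<le> (\<Sum>a\<in>\<Omega>. - log 2 (1 / card Y)) / card \<Omega>"
    using assms c by (intro shannon_entropy_le_cross_entropy)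
      (auto simp: divide_simps card_mono)
  also have "\<dots> = log 2 (card Y)"
    using assms(1,2) c by (auto simp: log_divide)
  finally show ?thesis .
qed

text \<open>The conjecture is stated for messages in the naturals; this lets messages of other
  countable types be renumbered without changing the capacities they need.\<close>

lemma shannon_entropy_inj:
  assumes "finite \<Omega>" "\<Omega> \<noteq> {}" "inj g"
  shows "shannon_entropy (uniform_count_measure \<Omega>) (\<lambda>a. g (X a)) =
    shannon_entropy (uniform_count_measure \<Omega>) X"
proof -
  have "(\<lambda>a. g (X a)) ` \<Omega> = g ` X ` \<Omega>" by auto
  then show ?thesis unfolding shannon_entropy_uniform[OF assms(1,2)]
    using assms(3) by (simp add: sum.reindex inj_on_subset inj_eq)
qed

lemma shannon_entropy_uniform_coordinate:
  assumes "finite I" "\<And>i. i \<in> I \<Longrightarrow> finite (S i) \<and> S i \<noteq> {}" "i \<in> I"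
  shows "shannon_entropy (uniform_count_measure (PiE I S)) (\<lambda>x. x i) = log 2 (card (S i))"
proof -
  let ?\<Omega> = "PiE I S"
  have fin: "finite ?\<Omega>" "?\<Omega> \<noteq> {}" using assms by (auto simp: finite_PiE PiE_eq_empty_iff)
  have im: "(\<lambda>x. x i) ` ?\<Omega> = S i"
    using assms fin by (simp add: image_projection_PiE)
  have N: "card ?\<Omega> > 0" using fin by (simp add: card_gt_0_iff)
  have C: "card (S i) > 0" using assms by (simp add: card_gt_0_iff)
  have fc: "card {x \<in> ?\<Omega>. x i = y} * card (S i) = card ?\<Omega>" if "y \<in> S i" for y
  proof -
    have e: "{x \<in> ?\<Omega>. x i = y} = PiE I (S(i := {y}))"
      using assms(3) that by (auto simp: PiE_iff extensional_def split: if_splits)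
    have I: "I = insert i (I - {i})" using assms(3) by auto
    have "card (PiE I (S(i := {y}))) = (\<Prod>j\<in>I. card ((S(i := {y})) j))"
      by (rule card_PiE[OF assms(1)])
    also have "\<dots> = (\<Prod>j\<in>I - {i}. card (S j))"
      using assms(1,3) by (subst prod.remove[of _ i]) auto
    finally have "card (PiE I (S(i := {y}))) = (\<Prod>j\<in>I - {i}. card (S j))" .
    moreover have "card ?\<Omega> = card (S i) * (\<Prod>j\<in>I - {i}. card (S j))"
      unfolding card_PiE[OF assms(1)] using assms(1,3) by (rule prod.remove)
    ultimately show ?thesis unfolding e by simp
  qed
  have p: "real (card {x \<in> ?\<Omega>. x i = y}) / card ?\<Omega> = 1 / card (S i)" if "y \<in> S i" for y
    using fc[OF that, THEN arg_cong[of _ _ real]] N C by (simp add: field_simps)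
  show ?thesis
    unfolding shannon_entropy_uniform[OF fin] im using C by (simp add: p log_divide)
qed

text \<open>Weak duality for one commodity. Summing flow times potential difference over all ordered
  pairs, conservation cancels every vertex except the two ends. Since only
  \<open>\<bar>\<phi> y - \<phi> x\<bar>\<close> is bounded, flow against the direction of an edge
  is charged as well.\<close>

lemma flow_cost_ge_potential:
  assumes G: "kpairs_instance G" and f: "multicommodity_flow G f" and i: "i < pairs G"
    and lip: "\<And>x y. (x, y) \<in> edges G \<Longrightarrow> \<bar>\<phi> y - \<phi> x\<bar> \<le> l (x, y)"
  shows "\<phi> (sink G i) - \<phi> (source G i) \<le> (\<Sum>(x, y)\<in>edges G. l (x, y) * (f i x y + f i y x))"
proof -
  let ?V = "verts G" and ?E = "edges G" and ?s = "source G i" and ?t = "sink G i"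
  note F = f[unfolded multicommodity_flow_def, rule_format, OF i]
  have fV: "finite ?V" and EV: "?E \<subseteq> ?V \<times> ?V" and ac: "acyclic ?E"
    and st: "?s \<in> ?V" "?t \<in> ?V" "?s \<noteq> ?t"
    using G i by (auto simp: kpairs_instance_def)
  have fE: "finite ?E" using fV EV by (meson finite_SigmaI finite_subset)
  have nn: "0 \<le> f i u v" for u v using F by auto
  have f0: "f i u v = 0" if "(u, v) \<notin> ?E" "(u, v) \<notin> ?E\<inverse>" for u v using F that by blast
  \<comment> \<open>Acyclicity excludes antiparallel edges, so the sum splits into \<open>?E\<close>
    and its converse without counting an edge twice.\<close>
  have disj: "?E \<inter> ?E\<inverse> = {}"
  proof -
    have "False" if "(u,v) \<in> ?E" "(v,u) \<in> ?E" for u v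
      using that ac unfolding acyclic_def by (meson trancl.simps)
    then show ?thesis by auto
  qed
  let ?g = "\<lambda>(u,v). f i u v * (\<phi> v - \<phi> u)"
  let ?D = "\<lambda>v. (\<Sum>u\<in>?V. f i u v) - (\<Sum>u\<in>?V. f i v u)"
  have "(\<Sum>p\<in>?V\<times>?V. ?g p) = (\<Sum>u\<in>?V. \<Sum>v\<in>?V. f i u v * \<phi> v) - (\<Sum>u\<in>?V. \<Sum>v\<in>?V. f i u v * \<phi> u)"
    by (simp add: sum.cartesian_product[symmetric] right_diff_distrib sum_subtractf)
  also have "(\<Sum>u\<in>?V. \<Sum>v\<in>?V. f i u v * \<phi> v) = (\<Sum>v\<in>?V. \<phi> v * (\<Sum>u\<in>?V. f i u v))"
    by (subst sum.swap) (simp add: sum_distrib_left mult.commute)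
  also have "(\<Sum>u\<in>?V. \<Sum>v\<in>?V. f i u v * \<phi> u) = (\<Sum>v\<in>?V. \<phi> v * (\<Sum>u\<in>?V. f i v u))"
    by (simp add: sum_distrib_left mult.commute)
  also have "(\<Sum>v\<in>?V. \<phi> v * (\<Sum>u\<in>?V. f i u v)) - (\<Sum>v\<in>?V. \<phi> v * (\<Sum>u\<in>?V. f i v u)) = (\<Sum>v\<in>?V. \<phi> v * ?D v)"
    by (simp add: sum_subtractf right_diff_distrib)
  also have "\<dots> = (\<Sum>v\<in>{?s,?t}. \<phi> v * ?D v)"
    using fV st F by (intro sum.mono_neutral_right) auto
  also have "\<dots> = \<phi> ?t - \<phi> ?s" using st F
    by (simp add: algebra_simps)
  finally have A: "(\<Sum>p\<in>?V\<times>?V. ?g p) = \<phi> ?t - \<phi> ?s" .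
  have "(\<Sum>p\<in>?V\<times>?V. ?g p) = (\<Sum>p\<in>?E \<union> ?E\<inverse>. ?g p)"
  proof (rule sum.mono_neutral_right)
    show "\<forall>p\<in>?V \<times> ?V - (?E \<union> ?E\<inverse>). ?g p = 0"
    proof
      fix p assume "p \<in> ?V \<times> ?V - (?E \<union> ?E\<inverse>)"
      then have "f i (fst p) (snd p) = 0" by (intro f0) auto
      then show "?g p = 0" by (simp add: split_beta)
    qed
  qed (use fV EV in auto)
  also have "\<dots> = (\<Sum>p\<in>?E. ?g p) + (\<Sum>p\<in>?E\<inverse>. ?g p)"
    using fE disj by (intro sum.union_disjoint) auto
  also have "(\<Sum>p\<in>?E\<inverse>. ?g p) = (\<Sum>(x,y)\<in>?E. ?g (y,x))"
  proof -
    have e: "?E\<inverse> = prod.swap ` ?E" by auto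
    show ?thesis unfolding e by (subst sum.reindex) (auto simp: split_beta)
  qed
  also have "(\<Sum>p\<in>?E. ?g p) + (\<Sum>(x,y)\<in>?E. ?g (y,x)) =
      (\<Sum>(x,y)\<in>?E. f i x y * (\<phi> y - \<phi> x) + f i y x * (\<phi> x - \<phi> y))"
    by (simp add: sum.distrib split_beta)
  also have "\<dots> \<le> (\<Sum>(x,y)\<in>?E. l (x,y) * (f i x y + f i y x))"
  proof (rule sum_mono, clarify)
    fix x y assume e: "(x,y) \<in> ?E"
    have "f i x y * (\<phi> y - \<phi> x) \<le> f i x y * l (x,y)" "f i y x * (\<phi> x - \<phi> y) \<le> f i y x * l (x,y)"
      using lip[OF e] nn by (auto intro!: mult_left_mono)
    then show "f i x y * (\<phi> y - \<phi> x) + f i y x * (\<phi> x - \<phi> y) \<le> l (x,y) * (f i x y + f i y x)"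
      by (simp add: algebra_simps)
  qed
  finally show ?thesis using A by simp
qed

text \<open>Each pair may have its own potential, but the lengths are common to all pairs; this is
  what allows the flows to be added up on each edge and compared with its capacity.\<close>

lemma flow_rate_potential_bound:
  assumes G: "kpairs_instance G" and r: "0 \<le> r" "flow_rate G r"
    and lip: "\<And>i x y. i < pairs G \<Longrightarrow> (x, y) \<in> edges G \<Longrightarrow> \<bar>\<phi> i y - \<phi> i x\<bar> \<le> l (x, y)"
    and l: "\<And>e. e \<in> edges G \<Longrightarrow> 0 \<le> l e"
  shows "r * (\<Sum>i<pairs G. \<phi> i (sink G i) - \<phi> i (source G i)) \<le> (\<Sum>e\<in>edges G. capacity G e * l e)"
proof -
  obtain f where f: "multicommodity_flow G f"
    and c: "\<forall>(u, v)\<in>edges G. r * (\<Sum>i<pairs G. f i u v + f i v u) \<le> capacity G (u, v)"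
    using r(2) by (auto simp: flow_rate_def)
  have "r * (\<Sum>i<pairs G. \<phi> i (sink G i) - \<phi> i (source G i)) \<le>
      r * (\<Sum>i<pairs G. \<Sum>(x, y)\<in>edges G. l (x, y) * (f i x y + f i y x))"
    using r(1) by (intro mult_left_mono sum_mono flow_cost_ge_potential[OF G f] lip) auto
  also have "\<dots> = (\<Sum>(x,y)\<in>edges G. l (x, y) * (r * (\<Sum>i<pairs G. f i x y + f i y x)))"
    by (subst sum.swap) (simp add: sum_distrib_left split_beta mult_ac)
  also have "\<dots> \<le> (\<Sum>(x,y)\<in>edges G. l (x, y) * capacity G (x, y))"
    using c l by (intro sum_mono) (auto intro!: mult_left_mono)
  finally show ?thesis by (simp add: split_beta mult.commute)
qed

text \<open>
  All alphabets may be taken to be \<^term>\<open>UNIV\<close>, so a family of messages comes from a coding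
  solution as soon as every message is a function of what its tail sees.
\<close>

lemma network_coding_solutionI:
  assumes S: "\<And>i. i < pairs G \<Longrightarrow> finite (S i) \<and> S i \<noteq> {}"
    and enc: "\<And>e A A'. e \<in> edges G \<Longrightarrow> A \<in> PiE {..<pairs G} S \<Longrightarrow> A' \<in> PiE {..<pairs G} S \<Longrightarrow>
      inputs_at G (fst e) A (msg A) = inputs_at G (fst e) A' (msg A') \<Longrightarrow> msg A e = msg A' e"
    and dec: "\<And>i A A'. i < pairs G \<Longrightarrow> A \<in> PiE {..<pairs G} S \<Longrightarrow> A' \<in> PiE {..<pairs G} S \<Longrightarrow>
      inputs_at G (sink G i) A (msg A) = inputs_at G (sink G i) A' (msg A') \<Longrightarrow> A i = A' i"
  shows "\<exists>enc dec. network_coding_solution G S (\<lambda>_. UNIV) enc dec msg"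
proof -
  let ?\<Omega> = "PiE {..<pairs G} S"
  \<comment> \<open>\<open>pre v z\<close> is an arbitrary global input compatible with the view
    \<open>z\<close> of node \<open>v\<close>; encoders and decoders replay \<open>msg\<close> on
    it.\<close>
  define pre where "pre v z = (SOME A. A \<in> ?\<Omega> \<and> inputs_at G v A (msg A) = z)" for v z
  have pre: "pre v (inputs_at G v A (msg A)) \<in> ?\<Omega>"
    "inputs_at G v (pre v (inputs_at G v A (msg A))) (msg (pre v (inputs_at G v A (msg A)))) =
      inputs_at G v A (msg A)" if "A \<in> ?\<Omega>" for v A
    using someI[of "\<lambda>A'. A' \<in> ?\<Omega> \<and> inputs_at G v A' (msg A') = inputs_at G v A (msg A)" A] that
    unfolding pre_def by blast+
  have "network_coding_solution G S (\<lambda>_. UNIV) (\<lambda>e z. msg (pre (fst e) z) e)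
      (\<lambda>i z. pre (sink G i) z i) msg"
    unfolding network_coding_solution_def
  proof (intro conjI ballI allI impI)
    fix A e assume "A \<in> ?\<Omega>" "e \<in> edges G"
    then show "msg A e = msg (pre (fst e) (inputs_at G (fst e) A (msg A))) e"
      using pre by (intro enc[of e A]) auto
  next
    fix A i assume "A \<in> ?\<Omega>" "i < pairs G"
    then show "pre (sink G i) (inputs_at G (sink G i) A (msg A)) i = A i"
      using pre by (simp add: dec[of i "pre (sink G i) (inputs_at G (sink G i) A (msg A))" A])
  qed (use S in auto)
  then show ?thesis by blast
qed

text \<open>The interface through which the conjecture enters. Vertices and messages may have any
  countable types, a rank increasing along edges certifies acyclicity, and the flow that the
  conjecture provides is at once traded for its dual inequality.\<close>

lemma k_pairs_potential_bound:
  fixes V :: "'v::countable set" and msg :: "(nat \<Rightarrow> nat) \<Rightarrow> 'v \<times> 'v \<Rightarrow> 'm::countable"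
    and rank :: "'v \<Rightarrow> nat"
  assumes conj: "undirected_k_pairs_conjecture"
    and V: "finite V" "E \<subseteq> V \<times> V" "\<And>x y. (x, y) \<in> E \<Longrightarrow> rank x < rank y"
    and cap: "\<And>e. e \<in> E \<Longrightarrow> 0 < c e"
    and st: "\<And>i. i < k \<Longrightarrow> s i \<in> V \<and> t i \<in> V \<and> s i \<noteq> t i"
    and S: "\<And>i. i < k \<Longrightarrow> finite (S i) \<and> S i \<noteq> {}"
    and enc: "\<And>x y A A'. (x, y) \<in> E \<Longrightarrow> A \<in> PiE {..<k} S \<Longrightarrow> A' \<in> PiE {..<k} S \<Longrightarrow>
      (\<And>i. i < k \<Longrightarrow> s i = x \<Longrightarrow> A i = A' i) \<Longrightarrow>
      (\<And>z. (z, x) \<in> E \<Longrightarrow> msg A (z, x) = msg A' (z, x)) \<Longrightarrow> msg A (x, y) = msg A' (x, y)"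
    and dec: "\<And>i A A'. i < k \<Longrightarrow> A \<in> PiE {..<k} S \<Longrightarrow> A' \<in> PiE {..<k} S \<Longrightarrow>
      (\<And>z. (z, t i) \<in> E \<Longrightarrow> msg A (z, t i) = msg A' (z, t i)) \<Longrightarrow> A i = A' i"
    and r: "0 < r" "\<And>i. i < k \<Longrightarrow> r \<le> log 2 (card (S i))"
    and ent: "\<And>e. e \<in> E \<Longrightarrow>
      shannon_entropy (uniform_count_measure (PiE {..<k} S)) (\<lambda>A. msg A e) \<le> c e"
    and lip: "\<And>i x y. i < k \<Longrightarrow> (x, y) \<in> E \<Longrightarrow> \<bar>\<phi> i y - \<phi> i x\<bar> \<le> l (x, y)"
    and l: "\<And>e. e \<in> E \<Longrightarrow> 0 \<le> l e"
  shows "r * (\<Sum>i<k. \<phi> i (t i) - \<phi> i (s i)) \<le> (\<Sum>e\<in>E. c e * l e)"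
proof -
  define P where "P = map_prod (to_nat :: 'v \<Rightarrow> nat) (to_nat :: 'v \<Rightarrow> nat)"
  define Q where "Q = map_prod (from_nat :: nat \<Rightarrow> 'v) (from_nat :: nat \<Rightarrow> 'v)"
  define G where "G = \<lparr>verts = to_nat ` V, edges = P ` E, capacity = c \<circ> Q, pairs = k,
    source = to_nat \<circ> s, sink = to_nat \<circ> t\<rparr>"
  define M where "M A e = to_nat (msg A (Q e))" for A e
  have QP [simp]: "Q (P e) = e" for e by (cases e) (simp add: P_def Q_def)
  have injP: "inj_on P X" for X by (metis QP inj_on_inverseI)
  have fst_P: "fst (P e) = to_nat (fst e)" for e by (simp add: P_def)
  have snd_P: "snd (P e) = to_nat (snd e)" for e by (simp add: P_def)
  have simps: "verts G = to_nat ` V" "edges G = P ` E" "capacity G = c \<circ> Q" "pairs G = k"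
    "source G = to_nat \<circ> s" "sink G = to_nat \<circ> t" by (simp_all add: G_def)
  have P_E: "(to_nat x, to_nat y) \<in> P ` E \<longleftrightarrow> (x, y) \<in> E" for x y :: 'v
    by (auto simp: P_def)
  have inst: "kpairs_instance G"
  proof -
    have "acyclic (P ` E)"
    proof (rule wf_acyclic, rule wf_subset)
      show "wf (inv_image less_than (\<lambda>x. rank (from_nat x :: 'v)))" by simp
      show "P ` E \<subseteq> inv_image less_than (\<lambda>x. rank (from_nat x :: 'v))"
        using V(3) by (auto simp: P_def)
    qed
    moreover have "P ` E \<subseteq> to_nat ` V \<times> to_nat ` V" using V(2) by (auto simp: P_def)
    ultimately show ?thesis using V st cap by (auto simp: kpairs_instance_def simps)
  qed
  have inp: "(\<forall>i. i < k \<longrightarrow> s i = x \<longrightarrow> A i = A' i) \<and>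
      (\<forall>z. (z, x) \<in> E \<longrightarrow> msg A (z, x) = msg A' (z, x))"
    if "inputs_at G (to_nat x) A (M A) = inputs_at G (to_nat x) A' (M A')" for x A A'
  proof -
    from that have 1: "restrict A (sources_at G (to_nat x)) = restrict A' (sources_at G (to_nat x))"
      and 2: "restrict (M A) (in_edges G (to_nat x)) = restrict (M A') (in_edges G (to_nat x))"
      by (auto simp: inputs_at_def)
    have "A i = A' i" if "i < k" "s i = x" for i
      using fun_cong[OF 1, of i] that by (simp add: sources_at_def simps)
    moreover have "msg A (z, x) = msg A' (z, x)" if "(z, x) \<in> E" for z
      using fun_cong[OF 2, of "P (z, x)"] that
      by (auto simp: in_edges_def simps M_def snd_P)
    ultimately show ?thesis by blast
  qed
  have "\<exists>enc dec. network_coding_solution G S (\<lambda>_. UNIV) enc dec M"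
  proof (rule network_coding_solutionI, goal_cases)
    case (1 i) then show ?case using S by (simp add: simps)
  next
    case (2 e A A')
    then obtain x y where e: "e = P (x, y)" "(x, y) \<in> E" by (auto simp: simps)
    have "inputs_at G (to_nat x) A (M A) = inputs_at G (to_nat x) A' (M A')"
      using 2(4) by (simp add: e fst_P)
    from inp[OF this] have "msg A (x, y) = msg A' (x, y)"
      using 2(2,3) by (intro enc[OF e(2)]) (auto simp: simps)
    then show ?case by (simp add: e M_def)
  next
    case (3 i A A')
    have "inputs_at G (to_nat (t i)) A (M A) = inputs_at G (to_nat (t i)) A' (M A')"
      using 3(4) by (simp add: simps)
    from inp[OF this] show ?case
      using 3(1-3) by (intro dec[of i A A']) (auto simp: simps)
  qed
  then obtain enc' dec' where sol: "network_coding_solution G S (\<lambda>_. UNIV) enc' dec' M" by blast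
  have fin: "finite (PiE {..<k} S)" "PiE {..<k} S \<noteq> {}"
    using S by (auto simp: PiE_eq_empty_iff intro!: finite_PiE)
  have "coding_rate G r"
    unfolding coding_rate_def
  proof (intro exI conjI)
    show "network_coding_solution G S (\<lambda>_. UNIV) enc' dec' M" by (rule sol)
    show "\<forall>i<pairs G. r \<le> shannon_entropy (source_space G S) (\<lambda>A. A i)"
      using r S shannon_entropy_uniform_coordinate[of "{..<k}" S] by (simp add: source_space_def simps)
    show "\<forall>e\<in>edges G. shannon_entropy (source_space G S) (\<lambda>A. M A e) \<le> capacity G e"
      using ent by (simp add: source_space_def simps M_def shannon_entropy_inj[OF fin inj_to_nat])
  qed
  then have fr: "flow_rate G r" using conj inst r(1) by (auto simp: undirected_k_pairs_conjecture_def)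
  have "r * (\<Sum>i<pairs G. (\<phi> i \<circ> from_nat) (sink G i) - (\<phi> i \<circ> from_nat) (source G i)) \<le>
      (\<Sum>e\<in>edges G. capacity G e * (l \<circ> Q) e)"
  proof (rule flow_rate_potential_bound[OF inst less_imp_le[OF r(1)] fr, where \<phi> = "\<lambda>i. \<phi> i \<circ> from_nat" and l = "l \<circ> Q"])
    show "\<bar>(\<phi> i \<circ> from_nat) y - (\<phi> i \<circ> from_nat) x\<bar> \<le> (l \<circ> Q) (x, y)"
      if "i < pairs G" "(x, y) \<in> edges G" for i x y
      using that lip by (auto simp: simps P_def Q_def)
    show "0 \<le> (l \<circ> Q) e" if "e \<in> edges G" for e
      using that l by (auto simp: simps)
  qed
  then show ?thesis
    by (simp add: simps sum.reindex[OF injP])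
qed

section \<open>Concentration in product spaces\<close>

text \<open>The left-hand side is half the sum of \<open>(f a - f b)\<^sup>2\<close> over all pairs.
  Variances are kept unnormalised, multiplied by the squared size of the space.\<close>

lemma variance_le_range:
  fixes f :: "'a \<Rightarrow> real"
  assumes "\<And>a b. a \<in> S \<Longrightarrow> b \<in> S \<Longrightarrow> \<bar>f a - f b\<bar> \<le> 1"
  shows "card S * (\<Sum>a\<in>S. (f a)\<^sup>2) - (\<Sum>a\<in>S. f a)\<^sup>2 \<le> (real (card S))\<^sup>2 / 2"
proof -
  have "(\<Sum>a\<in>S. \<Sum>b\<in>S. (f a - f b)\<^sup>2) = 2 * (card S * (\<Sum>a\<in>S. (f a)\<^sup>2) - (\<Sum>a\<in>S. f a)\<^sup>2)"
    by (simp add: power2_diff sum.distrib sum_subtractf sum_distrib_left[symmetric]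
        sum_distrib_right[symmetric] mult.assoc) (simp add: power2_eq_square algebra_simps sum_distrib_left)
  moreover have "(\<Sum>a\<in>S. \<Sum>b\<in>S. (f a - f b)\<^sup>2) \<le> (\<Sum>a\<in>S. \<Sum>b\<in>S. 1)"
    using assms by (intro sum_mono) (simp add: abs_square_le_1)
  ultimately show ?thesis by (simp add: power2_eq_square)
qed

lemma sum_PiE_insert:
  assumes "k \<notin> I"
  shows "(\<Sum>x\<in>PiE (insert k I) S. f x) = (\<Sum>x\<in>PiE I S. \<Sum>a\<in>S k. f (x(k := a)))"
proof -
  have "(\<Sum>x\<in>PiE (insert k I) S. f x) = (\<Sum>(a, x)\<in>S k \<times> PiE I S. f (x(k := a)))"
    unfolding PiE_insert_eq using assms
    by (subst sum.reindex[OF inj_combinator]) (auto simp: split_beta)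
  also have "\<dots> = (\<Sum>a\<in>S k. \<Sum>x\<in>PiE I S. f (x(k := a)))"
    by (simp add: sum.cartesian_product)
  finally show ?thesis by (subst (asm) sum.swap)
qed

text \<open>
  The Efron--Stein inequality, with the coordinates split off one at a time.
\<close>

lemma variance_le_lipschitz:
  fixes f :: "('i \<Rightarrow> 'a) \<Rightarrow> real"
  assumes "finite I" "finite S" "S \<noteq> {}"
    and "\<And>x i a. x \<in> PiE I (\<lambda>_. S) \<Longrightarrow> i \<in> I \<Longrightarrow> a \<in> S \<Longrightarrow> \<bar>f (x(i := a)) - f x\<bar> \<le> 1"
  shows "card (PiE I (\<lambda>_. S)) * (\<Sum>x\<in>PiE I (\<lambda>_. S). (f x)\<^sup>2) - (\<Sum>x\<in>PiE I (\<lambda>_. S). f x)\<^sup>2 \<le>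
    card I * (real (card (PiE I (\<lambda>_. S))))\<^sup>2 / 2"
  using assms(1,4)
proof (induction I arbitrary: f rule: finite_induct)
  case empty
  then show ?case by simp
next
  case (insert k I)
  let ?\<Omega> = "PiE I (\<lambda>_. S)" and ?\<Omega>' = "PiE (insert k I) (\<lambda>_. S)"
  define N where "N = real (card ?\<Omega>)"
  define q where "q = real (card S)"
  have q: "q > 0" using assms(2,3) by (simp add: q_def card_gt_0_iff)
  have N': "real (card ?\<Omega>') = N * q"
    using insert.hyps by (simp add: card_PiE N_def q_def)
  \<comment> \<open>\<open>g / q\<close> is the conditional mean over coordinate \<open>k\<close>.
    It is again 1-Lipschitz, so the induction hypothesis bounds its variance, while
    \<open>fib\<close> bounds the variance inside each fibre.\<close>
  define g where "g x = (\<Sum>a\<in>S. f (x(k := a)))" for x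
  have ext: "x(k := a) \<in> ?\<Omega>'" if "x \<in> ?\<Omega>" "a \<in> S" for x a
    using that by (auto simp: PiE_iff extensional_def)
  have g_lip: "\<bar>g (x(i := a)) / q - g x / q\<bar> \<le> 1" if "x \<in> ?\<Omega>" "i \<in> I" "a \<in> S" for x i a
  proof -
    have ik: "i \<noteq> k" using that insert.hyps by auto
    have "\<bar>g (x(i := a)) - g x\<bar> = \<bar>\<Sum>b\<in>S. f ((x(k := b))(i := a)) - f (x(k := b))\<bar>"
      using ik by (simp add: g_def sum_subtractf fun_upd_twist)
    also have "\<dots> \<le> (\<Sum>b\<in>S. 1)"
      using that by (intro order.trans[OF sum_abs] sum_mono insert.prems ext) auto
    finally show ?thesis using q by (simp add: q_def diff_divide_distrib[symmetric])
  qed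
  have IH: "N * (\<Sum>x\<in>?\<Omega>. (g x)\<^sup>2) - (\<Sum>x\<in>?\<Omega>. g x)\<^sup>2 \<le> card I * N\<^sup>2 / 2 * q\<^sup>2"
  proof -
    have "N * (\<Sum>x\<in>?\<Omega>. (g x / q)\<^sup>2) - (\<Sum>x\<in>?\<Omega>. g x / q)\<^sup>2 \<le> card I * N\<^sup>2 / 2"
      unfolding N_def by (rule insert.IH[OF g_lip])
    then have "(N * (\<Sum>x\<in>?\<Omega>. (g x)\<^sup>2) - (\<Sum>x\<in>?\<Omega>. g x)\<^sup>2) / q\<^sup>2 \<le> card I * N\<^sup>2 / 2"
      by (simp add: power_divide sum_divide_distrib[symmetric] diff_divide_distrib)
    then show ?thesis using q by (subst (asm) pos_divide_le_eq) auto
  qed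
  have fib: "q * (\<Sum>a\<in>S. (f (x(k := a)))\<^sup>2) \<le> (g x)\<^sup>2 + q\<^sup>2 / 2" if "x \<in> ?\<Omega>" for x
  proof -
    have "\<bar>f (x(k := a)) - f (x(k := b))\<bar> \<le> 1" if "a \<in> S" "b \<in> S" for a b
      using insert.prems[OF ext[OF \<open>x \<in> ?\<Omega>\<close> \<open>b \<in> S\<close>], of k a] that
      by (simp only: fun_upd_upd insertI1 simp_thms)
    from variance_le_range[of S "\<lambda>a. f (x(k := a))", OF this] show ?thesis
      by (simp add: g_def q_def)
  qed
  have "N * q * (\<Sum>x\<in>?\<Omega>'. (f x)\<^sup>2) - (\<Sum>x\<in>?\<Omega>'. f x)\<^sup>2 =
      N * (\<Sum>x\<in>?\<Omega>. q * (\<Sum>a\<in>S. (f (x(k := a)))\<^sup>2)) - (\<Sum>x\<in>?\<Omega>. g x)\<^sup>2"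
    using insert.hyps by (simp add: sum_PiE_insert g_def sum_distrib_left mult.assoc)
  also have "\<dots> \<le> N * (\<Sum>x\<in>?\<Omega>. (g x)\<^sup>2 + q\<^sup>2 / 2) - (\<Sum>x\<in>?\<Omega>. g x)\<^sup>2"
    by (intro diff_right_mono mult_left_mono sum_mono fib) (simp_all add: N_def)
  also have "\<dots> = (N * (\<Sum>x\<in>?\<Omega>. (g x)\<^sup>2) - (\<Sum>x\<in>?\<Omega>. g x)\<^sup>2) + N\<^sup>2 * q\<^sup>2 / 2"
    by (simp add: sum.distrib N_def power2_eq_square algebra_simps)
  also have "\<dots> \<le> card I * N\<^sup>2 / 2 * q\<^sup>2 + N\<^sup>2 * q\<^sup>2 / 2"
    using IH by simp
  also have "\<dots> = card (insert k I) * (N * q)\<^sup>2 / 2"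
    using insert.hyps by (simp add: power_mult_distrib algebra_simps)
  finally show ?case by (simp add: N')
qed

text \<open>
  The Hamming distance from \<open>G\<close> is 1-Lipschitz and vanishes on a quarter of the space, so its
  variance bounds its mean.
\<close>

lemma nearest_point_map:
  fixes G :: "('i \<Rightarrow> 'a) set"
  assumes "finite I" "finite S" "S \<noteq> {}"
    and G: "G \<subseteq> PiE I (\<lambda>_. S)" "card (PiE I (\<lambda>_. S)) \<le> 4 * card G"
  obtains \<nu> where "\<And>x. \<nu> x \<in> G"
    "(\<Sum>x\<in>PiE I (\<lambda>_. S). real (card {i \<in> I. \<nu> x i \<noteq> x i})) \<le> card (PiE I (\<lambda>_. S)) * sqrt (2 * card I)"
proof -
  let ?\<Omega> = "PiE I (\<lambda>_. S)"
  have fin: "finite ?\<Omega>" "?\<Omega> \<noteq> {}" using assms by (auto simp: PiE_eq_empty_iff intro!: finite_PiE)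
  have N: "card ?\<Omega> > 0" using fin by (simp add: card_gt_0_iff)
  have fG: "finite G" using G fin finite_subset by blast
  have G0: "G \<noteq> {}" using G N by auto
  define ham where "ham x y = card {i \<in> I. y i \<noteq> x i}" for x y :: "'i \<Rightarrow> 'a"
  define \<nu> where "\<nu> x = arg_min_on (ham x) G" for x
  have \<nu>: "\<nu> x \<in> G" for x unfolding \<nu>_def by (rule arg_min_if_finite[OF fG G0])
  have least: "ham x (\<nu> x) \<le> ham x y" if "y \<in> G" for x y
    unfolding \<nu>_def by (rule arg_min_least[OF fG G0 that])
  define D where "D x = real (ham x (\<nu> x))" for x
  have D_up: "D (x(i := a)) \<le> D x + 1" for x i a
  proof -
    have "ham (x(i := a)) (\<nu> (x(i := a))) \<le> ham (x(i := a)) (\<nu> x)" by (rule least[OF \<nu>])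
    also have "\<dots> \<le> card (insert i {j \<in> I. \<nu> x j \<noteq> x j})"
      unfolding ham_def using assms(1) by (intro card_mono) auto
    also have "\<dots> \<le> ham x (\<nu> x) + 1"
      unfolding ham_def using assms(1) by (simp add: card_insert_if)
    finally show ?thesis by (simp add: D_def)
  qed
  have lip: "\<bar>D (x(i := a)) - D x\<bar> \<le> 1" for x i a
    using D_up[of x i a] D_up[of "x(i := a)" i "x i"] by simp
  have D0: "D x = 0" if "x \<in> G" for x
    using least[OF that, of x] by (simp add: D_def ham_def)
  define T where "T = (\<Sum>x\<in>?\<Omega>. D x)"
  define Q where "Q = (\<Sum>x\<in>?\<Omega>. (D x)\<^sup>2)"
  define M where "M = real (card ?\<Omega>)"
  have var: "M * Q - T\<^sup>2 \<le> card I * M\<^sup>2 / 2"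
    unfolding M_def Q_def T_def by (intro variance_le_lipschitz assms lip)
  \<comment> \<open>Cauchy-Schwarz over the at most three quarters of the space where
    \<open>D\<close> can be nonzero gives \<open>T\<^sup>2 \<le> 3 / 4 * (M * Q)\<close>. Together
    with \<open>var\<close> this can be solved for \<open>T\<close>.\<close>
  have "T = (\<Sum>x\<in>?\<Omega> - G. D x)"
    unfolding T_def using fin D0 by (intro sum.mono_neutral_right) auto
  then have "T\<^sup>2 \<le> (\<Sum>x\<in>?\<Omega> - G. (D x)\<^sup>2) * card (?\<Omega> - G)"
    by (simp add: sum_squared_le_sum_of_squares)
  also have "\<dots> \<le> Q * (3 / 4 * M)"
  proof (intro mult_mono)
    show "(\<Sum>x\<in>?\<Omega> - G. (D x)\<^sup>2) \<le> Q" unfolding Q_def using fin by (intro sum_mono2) auto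
    show "real (card (?\<Omega> - G)) \<le> 3 / 4 * M"
      unfolding M_def using G fG fin card_mono[OF fin(1) G(1)]
      by (simp add: card_Diff_subset of_nat_diff)
  qed (auto simp: Q_def intro: sum_nonneg)
  also have "\<dots> = 3 / 4 * (M * Q)" by simp
  finally have "T\<^sup>2 \<le> 3 / 2 * card I * M\<^sup>2" using var by simp
  also have "\<dots> \<le> 2 * card I * M\<^sup>2" by (intro mult_right_mono) auto
  also have "\<dots> = (M * sqrt (2 * card I))\<^sup>2" by (simp add: power_mult_distrib)
  finally have "T \<le> M * sqrt (2 * card I)" by (rule power2_le_imp_le) (simp add: M_def)
  then have "(\<Sum>x\<in>?\<Omega>. real (card {i \<in> I. \<nu> x i \<noteq> x i})) \<le> card ?\<Omega> * sqrt (2 * card I)"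
    by (simp add: T_def M_def D_def ham_def)
  with \<nu> show thesis by (rule that[of \<nu>])
qed

section \<open>Runs of external memory algorithms\<close>

lemma em_run_lengths:
  assumes A: "em_algorithm m b A" and D: "\<And>a. length (D a) = b"
  shows "(\<forall>s. fst (em_run A D \<tau>) = Some s \<longrightarrow> length s = m) \<and> (\<forall>a. length (snd (em_run A D \<tau>) a) = b)"
proof (induction \<tau>)
  case 0
  then show ?case using assms by (simp add: em_algorithm_def)
next
  case (Suc \<tau>)
  obtain ms X where r: "em_run A D \<tau> = (ms, X)" by fastforce
  show ?case
  proof (cases ms)
    case None
    then show ?thesis using Suc r by simp
  next
    case (Some s)
    then have s: "length s = m" and X: "\<And>a. length (X a) = b" using Suc r by auto
    have "case next_action A \<tau> s of Halt \<Rightarrow> True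
      | ReadBlock a g \<Rightarrow> \<forall>x. length x = b \<longrightarrow> length (g x) = m
      | WriteBlock a x s' \<Rightarrow> length x = b \<and> length s' = m"
      using A s unfolding em_algorithm_def by blast
    then show ?thesis using X r Some by (cases "next_action A \<tau> s") simp_all
  qed
qed

lemmas em_run_mem_length = em_run_lengths[THEN conjunct1, rule_format]
lemmas em_run_block_length = em_run_lengths[THEN conjunct2, rule_format]

definition accessed :: "(nat \<Rightarrow> io option) \<Rightarrow> nat \<Rightarrow> nat \<Rightarrow> nat set" where
  "accessed p \<sigma> \<tau> = {a. \<exists>\<rho>. \<sigma> \<le> \<rho> \<and> \<rho> < \<tau> \<and> (p \<rho> = Some (Read a) \<or> p \<rho> = Some (Write a))}"

lemma accessed_subset_image: "accessed p \<sigma> \<tau> \<subseteq> (\<lambda>\<rho>. case p \<rho> of Some (Read a) \<Rightarrow> a | Some (Write a) \<Rightarrow> a | None \<Rightarrow> 0) ` {\<sigma>..<\<tau>}"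
proof
  fix a assume "a \<in> accessed p \<sigma> \<tau>"
  then obtain \<rho> where "\<rho> \<in> {\<sigma>..<\<tau>}" "p \<rho> = Some (Read a) \<or> p \<rho> = Some (Write a)"
    by (auto simp: accessed_def)
  then show "a \<in> (\<lambda>\<rho>. case p \<rho> of Some (Read a) \<Rightarrow> a | Some (Write a) \<Rightarrow> a | None \<Rightarrow> 0) ` {\<sigma>..<\<tau>}"
    by (intro image_eqI[of _ _ \<rho>]) auto
qed

lemma finite_accessed [simp]: "finite (accessed p \<sigma> \<tau>)"
  by (rule finite_subset[OF accessed_subset_image]) simp

lemma card_accessed_le: "card (accessed p \<sigma> \<tau>) \<le> \<tau> - \<sigma>"
  using card_mono[OF _ accessed_subset_image[of p \<sigma> \<tau>]] card_image_le[of "{\<sigma>..<\<tau>}"]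
  by (metis (no_types, lifting) card_atLeastLessThan finite_atLeastLessThan finite_imageI le_trans)

lemma accessed_mono: "\<sigma> \<le> \<sigma>' \<Longrightarrow> \<tau>' \<le> \<tau> \<Longrightarrow> accessed p \<sigma>' \<tau>' \<subseteq> accessed p \<sigma> \<tau>"
  unfolding accessed_def by (auto intro: order.trans less_le_trans)

lemma em_run_Suc_cong:
  assumes "access_pattern A D \<tau> = access_pattern A D' \<tau>"
    and "fst (em_run A D \<tau>) = fst (em_run A D' \<tau>)"
    and "\<And>a. a \<in> X \<Longrightarrow> snd (em_run A D \<tau>) a = snd (em_run A D' \<tau>) a"
    and "accessed (access_pattern A D) \<tau> (Suc \<tau>) \<subseteq> X"
  shows "fst (em_run A D (Suc \<tau>)) = fst (em_run A D' (Suc \<tau>)) \<and>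
    (\<forall>a\<in>X. snd (em_run A D (Suc \<tau>)) a = snd (em_run A D' (Suc \<tau>)) a)"
proof -
  obtain ms Y Y' where r: "em_run A D \<tau> = (ms, Y)" "em_run A D' \<tau> = (ms, Y')"
    using assms(2) by (metis prod.collapse)
  show ?thesis
  proof (cases ms)
    case None
    then show ?thesis using r assms(3) by simp
  next
    case (Some s)
    show ?thesis
    proof (cases "next_action A \<tau> s")
      case (ReadBlock a g)
      then have "access_pattern A D \<tau> = Some (Read a)"
        using r Some by (simp add: access_pattern_def)
      then have "a \<in> X" using assms(4) by (auto simp: accessed_def)
      then show ?thesis using r Some ReadBlock assms(3) by simp
    qed (use r Some assms(3) in auto)
  qed
qed

text \<open>Two runs with the same access pattern touch the same blocks at the same times, so no
  other block can influence the segment from \<open>\<sigma>\<close> to \<open>\<tau>\<close>. This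
  is why a single node fed by the memory and the accessed blocks can simulate an epoch.\<close>

lemma em_run_accessed_cong:
  assumes "\<And>\<rho>. access_pattern A D \<rho> = access_pattern A D' \<rho>" "\<sigma> \<le> \<tau>"
    and "fst (em_run A D \<sigma>) = fst (em_run A D' \<sigma>)"
    and "\<And>a. a \<in> accessed (access_pattern A D) \<sigma> \<tau> \<Longrightarrow> snd (em_run A D \<sigma>) a = snd (em_run A D' \<sigma>) a"
  shows "fst (em_run A D \<tau>) = fst (em_run A D' \<tau>) \<and>
    (\<forall>a\<in>accessed (access_pattern A D) \<sigma> \<tau>. snd (em_run A D \<tau>) a = snd (em_run A D' \<tau>) a)"
proof -
  let ?X = "accessed (access_pattern A D) \<sigma> \<tau>"
  have "fst (em_run A D \<rho>) = fst (em_run A D' \<rho>) \<and>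
    (\<forall>a\<in>?X. snd (em_run A D \<rho>) a = snd (em_run A D' \<rho>) a)" if "\<rho> \<le> \<tau>" "\<sigma> \<le> \<rho>" for \<rho>
    using that(2,1)
  proof (induction \<rho> rule: dec_induct)
    case base
    then show ?case using assms(3,4) by blast
  next
    case (step \<rho>)
    show ?case
    proof (rule em_run_Suc_cong[OF assms(1)])
      show "accessed (access_pattern A D) \<rho> (Suc \<rho>) \<subseteq> ?X"
        using step by (intro accessed_mono) auto
    qed (use step in auto)
  qed
  then show ?thesis using assms(2) by blast
qed

lemma em_run_unaccessed:
  assumes "\<sigma> \<le> \<tau>" "a \<notin> accessed (access_pattern A D) \<sigma> \<tau>"
  shows "snd (em_run A D \<tau>) a = snd (em_run A D \<sigma>) a"
  using assms
proof (induction \<tau> rule: dec_induct)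
  case (step \<rho>)
  have "a \<notin> accessed (access_pattern A D) \<sigma> \<rho>"
    using step.prems accessed_mono[of \<sigma> \<sigma> \<rho> "Suc \<rho>"] by auto
  moreover have "snd (em_run A D (Suc \<rho>)) a = snd (em_run A D \<rho>) a"
  proof -
    have "access_pattern A D \<rho> \<noteq> Some (Write a)"
      using step by (auto simp: accessed_def)
    then show ?thesis
      by (cases "em_run A D \<rho>" rule: prod.exhaust; cases "fst (em_run A D \<rho>)")
        (auto simp: access_pattern_def split: action.splits)
  qed
  ultimately show ?case using step by simp
qed simp

text \<open>The step that halts performs no I/O but still advances time, hence the
  \<open>Suc\<close>.\<close>

lemma access_pattern_eq_None_iff:
  "access_pattern A D \<tau> = None \<longleftrightarrow> fst (em_run A D (Suc \<tau>)) = None"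
  by (cases "em_run A D \<tau>"; cases "fst (em_run A D \<tau>)")
    (auto simp: access_pattern_def split: action.splits)

lemma em_run_halted:
  assumes "fst (em_run A D \<sigma>) = None" "\<sigma> \<le> \<tau>"
  shows "em_run A D \<tau> = em_run A D \<sigma>"
  using assms(2,1)
  by (induction \<tau> rule: dec_induct) (simp, metis em_run.simps(2) em_step.simps(1) prod.collapse)

lemma io_count_cases:
  obtains "io_count A D = \<infinity>"
  | t where "io_count A D = ennreal (real t)" "\<And>\<tau>. access_pattern A D \<tau> = None \<longleftrightarrow> t \<le> \<tau>"
proof (cases "\<exists>\<tau>. access_pattern A D \<tau> = None")
  case True
  define t where "t = (LEAST \<tau>. access_pattern A D \<tau> = None)"
  have t: "access_pattern A D t = None" using True unfolding t_def by (rule LeastI_ex)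
  have "access_pattern A D \<tau> = None \<longleftrightarrow> t \<le> \<tau>" for \<tau>
  proof
    assume "t \<le> \<tau>"
    then show "access_pattern A D \<tau> = None"
      using t em_run_halted[of A D "Suc t" "Suc \<tau>"] by (simp add: access_pattern_eq_None_iff del: em_run.simps)
  qed (simp add: t_def Least_le)
  moreover from this have "{\<tau>. access_pattern A D \<tau> \<noteq> None} = {..<t}" by auto
  then have "io_count A D = ennreal (real t)" by (simp add: io_count_def ennreal_of_nat_eq_real_of_nat)
  ultimately show thesis by (rule that(2)[of t, rotated])
next
  case False
  then have "{\<tau>. access_pattern A D \<tau> \<noteq> None} = UNIV" by auto
  then show thesis by (intro that(1)) (simp add: io_count_def)
qed

lemma em_run_Some:
  assumes "\<And>\<tau>. access_pattern A D \<tau> = None \<longleftrightarrow> t \<le> \<tau>" "\<tau> \<le> t"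
  shows "\<exists>s. fst (em_run A D \<tau>) = Some s"
  using assms access_pattern_eq_None_iff[of A D "\<tau> - 1"] by (cases \<tau>) (auto simp del: em_run.simps(2))

lemma em_run_final:
  assumes t: "\<And>\<tau>. access_pattern A D \<tau> = None \<longleftrightarrow> t \<le> \<tau>" and "t < \<tau>" "halts_with A D D'"
  shows "snd (em_run A D \<tau>) = D'"
proof -
  obtain \<sigma> where \<sigma>: "em_run A D \<sigma> = (None, D')" using assms(3) by (auto simp: halts_with_def)
  have "fst (em_run A D (Suc t)) = None" using t access_pattern_eq_None_iff[of A D t] by simp
  then have "em_run A D (max \<sigma> \<tau>) = em_run A D \<tau>"
    using assms(2) em_run_halted[of A D "Suc t" \<tau>] em_run_halted[of A D "Suc t" "max \<sigma> \<tau>"]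
    by (simp del: em_run.simps)
  moreover have "em_run A D (max \<sigma> \<tau>) = em_run A D \<sigma>" using \<sigma> by (intro em_run_halted) auto
  ultimately show ?thesis using \<sigma> by (metis snd_conv)
qed

lemma em_run_final_unaccessed:
  assumes t: "\<And>\<tau>. access_pattern A D \<tau> = None \<longleftrightarrow> t \<le> \<tau>"
    and "halts_with A D D'" "a \<notin> accessed (access_pattern A D) 0 t"
  shows "D' a = D a"
proof -
  have "a \<notin> accessed (access_pattern A D) 0 (Suc t)"
    using assms(3) t[of t] by (auto simp: accessed_def less_Suc_eq)
  from em_run_unaccessed[OF _ this] em_run_final[OF t, of "Suc t" D'] assms(2) show ?thesis
    by (simp del: em_run.simps(2))
qed

section \<open>Bit layout of the input and output arrays\<close>

lemma length_concat_map_const: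
  "(\<And>i. i \<in> set xs \<Longrightarrow> length (f i) = L) \<Longrightarrow> length (concat (map f xs)) = length xs * L"
  by (induction xs) auto

lemma nth_concat_map_upt:
  assumes "\<And>i. i \<in> {1..n} \<Longrightarrow> length (f i) = L" "p < n * L"
  shows "concat (map f [1..<Suc n]) ! p = f (Suc (p div L)) ! (p mod L)"
  using assms
proof (induction n)
  case (Suc n)
  have len: "length (concat (map f [1..<Suc n])) = n * L"
    using Suc.prems(1) by (subst length_concat_map_const[of _ _ L]) auto
  have split: "concat (map f [1..<Suc (Suc n)]) = concat (map f [1..<Suc n]) @ f (Suc n)" by simp
  show ?case
  proof (cases "p < n * L")
    case True
    then show ?thesis unfolding split nth_append len using Suc by (simp del: upt_Suc)
  next
    case False
    then have d: "p div L = n"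
      using Suc.prems(2) by (auto intro!: div_nat_eqI simp: algebra_simps)
    moreover have "p mod L = p - n * L" by (simp only: d modulo_nat_def)
    ultimately have "p div L = n" "p mod L = p - n * L" by blast+
    then show ?thesis unfolding split nth_append len using False by (simp del: upt_Suc)
  qed
qed simp

lemma length_binary [simp]: "length (binary l x) = l"
  by (simp add: binary_def)

lemma inj_on_binary: "inj_on (binary w) {..<2 ^ w}"
proof (rule inj_onI)
  fix x y :: nat assume xy: "x \<in> {..<2 ^ w}" "y \<in> {..<2 ^ w}" "binary w x = binary w y"
  have "bit x j = bit y j" if "j < w" for j
    using arg_cong[OF xy(3), of "\<lambda>l. l ! j"] that by (simp add: binary_def)
  then have "take_bit w x = take_bit w y" by (intro bit_eqI) (auto simp: bit_take_bit_iff)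
  then show "x = y" using xy by (simp add: take_bit_nat_eq_self)
qed

lemma binary_0: "binary w 0 = replicate w False"
  by (rule nth_equalityI) (auto simp: binary_def)

lemma lg_ceil_le: "log 2 (real n) \<le> real w \<Longrightarrow> lg_ceil n \<le> w"
  unfolding lg_ceil_def by (simp add: ceiling_le_iff nat_le_iff)

lemma length_block_of [simp]: "length (block_of b xs a) = b"
  by (simp add: block_of_def)

lemma length_input_bits:
  assumes "\<And>i. i \<in> {1..n} \<Longrightarrow> length (d i) = w"
  shows "length (input_bits n w \<pi> d) = n * (w + lg_ceil n)"
  unfolding input_bits_def using assms
  by (subst length_concat_map_const[of _ _ "w + lg_ceil n"]) auto

definition first_block :: "nat \<Rightarrow> nat \<Rightarrow> nat \<Rightarrow> nat \<Rightarrow> nat" where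
  "first_block n w B i = i * (w + lg_ceil n) div (B * w)"

text \<open>Entry \<open>i + 1\<close> has at most \<open>2 w \<le> 2 b\<close> bits, so it meets at most three blocks.\<close>

lemma input_disk_cong:
  assumes "1 \<le> w" "1 \<le> B" "lg_ceil n \<le> w"
    and len: "\<And>i. i \<in> {1..n} \<Longrightarrow> length (d i) = w" "\<And>i. i \<in> {1..n} \<Longrightarrow> length (d' i) = w"
    and eq: "\<And>i. i < n \<Longrightarrow> first_block n w B i \<le> a \<Longrightarrow> a \<le> first_block n w B i + 2 \<Longrightarrow>
      d (Suc i) = d' (Suc i)"
  shows "input_disk n w B \<pi> d a = input_disk n w B \<pi> d' a"
proof -
  let ?L = "w + lg_ceil n" and ?b = "B * w"
  have wb: "w \<le> ?b" using assms(1,2) by simp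
  have bit: "input_bits n w \<pi> d ! p = input_bits n w \<pi> d' ! p" if p: "p < n * ?L" "p div ?b = a" for p
  proof -
    let ?i = "p div ?L"
    have i: "?i < n" using p by (simp add: less_mult_imp_div_less)
    have p1: "?i * ?L \<le> p" by (simp add: div_times_less_eq_dividend)
    have p2: "p < ?i * ?L + 2 * ?b"
    proof -
      have "p = ?i * ?L + p mod ?L" by (simp only: div_mult_mod_eq)
      moreover have "p mod ?L < ?L" using assms(1) by (intro mod_less_divisor) simp
      ultimately have "p < ?i * ?L + ?L" by linarith
      then show ?thesis using assms(3) wb by linarith
    qed
    have "a \<le> (?i * ?L + 2 * ?b) div ?b" using p(2) p2 by (metis div_le_mono less_imp_le)
    then have "d (Suc ?i) = d' (Suc ?i)"
      using assms(1,2) p(2) i div_le_mono[OF p1, of ?b] by (intro eq) (auto simp: first_block_def)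
    then show ?thesis
      unfolding input_bits_def using p i
      by (subst (1 2) nth_concat_map_upt[of _ _ ?L]) (auto simp: len)
  qed
  show ?thesis
    unfolding input_disk_def block_of_def
  proof (rule map_cong[OF refl])
    fix j assume "j \<in> set [0..<?b]"
    then have "(a * ?b + j) div ?b = a" by (intro div_nat_eqI) (auto simp: algebra_simps)
    then show "(a * ?b + j < length (input_bits n w \<pi> d) \<and> input_bits n w \<pi> d ! (a * ?b + j)) =
        (a * ?b + j < length (input_bits n w \<pi> d') \<and> input_bits n w \<pi> d' ! (a * ?b + j))"
      using bit[of "a * ?b + j"] length_input_bits[of n d, OF len(1)] length_input_bits[of n d', OF len(2)]
      by auto
  qed
qed

lemma input_disk_beyond_input:
  assumes "1 \<le> w" "1 \<le> B" "\<And>i. i \<in> {1..n} \<Longrightarrow> length (d i) = w" "output_base n w B \<le> a"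
  shows "input_disk n w B \<pi> d a = replicate (B * w) False"
proof -
  have "real (n * (w + lg_ceil n)) / real (B * w) \<le> real a"
    using assms(4) by (simp add: output_base_def nat_le_iff ceiling_le_iff)
  then have "real (n * (w + lg_ceil n)) \<le> real (a * (B * w))"
    using assms(1,2) by (simp add: pos_divide_le_eq)
  then have "n * (w + lg_ceil n) \<le> a * (B * w)" by (simp only: of_nat_le_iff)
  then show ?thesis
    using length_input_bits[of n d w \<pi>, OF assms(3)]
    by (intro nth_equalityI) (auto simp: input_disk_def block_of_def)
qed

lemma output_word_replicate:
  assumes "1 \<le> B" "D (output_base n w B + (j - 1) div B) = replicate (B * w) False"
  shows "output_word n w B D j = replicate w False"
proof -
  have "(j - 1) mod B < B" using assms(1) by (intro mod_less_divisor) simp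
  then have "((j - 1) mod B + 1) * w \<le> B * w" by (intro mult_le_mono1) simp
  then have "w \<le> B * w - (j - 1) mod B * w" by (simp add: add_mult_distrib)
  then show ?thesis using assms(2) by (simp add: output_word_def min_def)
qed

section \<open>The graph of epochs\<close>

text \<open>
  \<open>Src i\<close>, \<open>Enc i\<close> and \<open>Snk i\<close> belong to entry \<open>i + 1\<close>: its source, the encoder choosing the
  data actually fed to the algorithm, and its sink.  \<open>Coord\<close> is a coordinator that sees all sources.
  \<open>Mem e\<close> is the memory during epoch \<open>e\<close>, \<open>Blk e a\<close> the block at address \<open>a\<close> at the start of epoch \<open>e\<close>.
\<close>

datatype vertex = Src nat | Enc nat | Coord | Snk nat | Blk nat nat | Mem nat

instance vertex :: countable by countable_datatype

lemma card_iterated_nbrs_le: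
  fixes N :: "'v \<Rightarrow> 'v set"
  assumes "\<And>x. finite (N x)" "\<And>x. card (N x) \<le> \<Delta>"
  shows "finite (((\<lambda>X. \<Union>(N ` X)) ^^ k) {x}) \<and> card (((\<lambda>X. \<Union>(N ` X)) ^^ k) {x}) \<le> \<Delta> ^ k"
proof (induction k)
  case (Suc k)
  let ?B = "((\<lambda>X. \<Union>(N ` X)) ^^ k) {x}"
  have "card (\<Union>(N ` ?B)) \<le> (\<Sum>y\<in>?B. card (N y))" using Suc by (intro card_UN_le) auto
  also have "\<dots> \<le> card ?B * \<Delta>" using sum_bounded_above[of ?B "\<lambda>y. card (N y)" \<Delta>] assms(2) by simp
  also have "\<dots> \<le> \<Delta> ^ Suc k" using Suc by simp
  finally show ?case using Suc assms(1) by simp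
qed simp

text \<open>Nothing here refers to an input. Obliviousness fixes the graph before the permutation is
  drawn, so a random permutation can be tested against fixed distances.\<close>

locale epochs =
  fixes p :: "nat \<Rightarrow> io option" and K :: nat
  assumes K_pos: "1 \<le> K"
begin

definition acc :: "nat \<Rightarrow> nat set" where
  "acc e = accessed p (e * K) (Suc e * K)"

lemma finite_acc [simp]: "finite (acc e)"
  by (simp add: acc_def)

lemma card_acc_le: "card (acc e) \<le> K"
  using card_accessed_le[of p "e * K" "Suc e * K"] by (simp add: acc_def)

text \<open>The node where the contents of \<open>Blk e a\<close> were last produced.\<close>

primrec origin :: "nat \<Rightarrow> nat \<Rightarrow> vertex" where
  "origin 0 a = Blk 0 a"
| "origin (Suc e) a = (if a \<in> acc e then Mem e else origin e a)"

lemma origin_cases: "origin e a = Blk 0 a \<or> (\<exists>e'. origin e a = Mem e')"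
  by (induction e) auto

lemma origin_eq_Blk: "origin e a = Blk e' a' \<Longrightarrow> a' = a"
  by (induction e) (auto split: if_splits)

lemma origin_eq_Mem: "origin e a = Mem e' \<Longrightarrow> a \<in> acc e' \<and> e' < e"
  by (induction e) (auto split: if_splits)

lemma origin_after_access: "e0 < e \<Longrightarrow> a \<in> acc e0 \<Longrightarrow> \<exists>e'\<ge>e0. origin e a = Mem e'"
  by (induction e) (auto simp: less_Suc_eq)

text \<open>At the start of an epoch the origin lies strictly earlier; once the block is accessed,
  it moves to that epoch or a later one. Hence what one node produces at one address is read by at
  most one epoch, which bounds the degree.\<close>

lemma origin_access_unique:
  assumes "origin e a = origin e' a" "a \<in> acc e" "a \<in> acc e'"
  shows "e = e'"
proof -
  have "\<not> e1 < e2" if "origin e1 a = origin e2 a" "a \<in> acc e1" for e1 e2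
    using origin_after_access[of e1 e2 a] origin_eq_Mem[of e1 a] that by fastforce
  from this[of e e'] this[of e' e] assms show ?thesis by simp
qed

text \<open>The network without the coordinator, after contracting its edges of length 0: a source
  is identified with its first input block and a block with its origin. The first family is needed
  because an entry may spread over three consecutive blocks.\<close>

definition adj :: "(vertex \<times> vertex) set" where
  "adj = {(Blk 0 a, Blk 0 a') |a a'. a \<le> a' \<and> a' \<le> a + 2} \<union>
    {(origin e a, Mem e) |e a. a \<in> acc e} \<union> {(Mem e, Mem (Suc e)) |e. True}"

text \<open>Both directions, because flow may run against the edges; \<open>x\<close> itself, so
  that the balls \<open>reach\<close> are nested.\<close>

definition nbrs :: "vertex \<Rightarrow> vertex set" where
  "nbrs x = insert x (adj `` {x} \<union> adj\<inverse> `` {x})"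

lemma nbrs_sym: "y \<in> nbrs x \<Longrightarrow> x \<in> nbrs y"
  by (auto simp: nbrs_def)

lemma origin_neq [simp]: "origin e a \<noteq> Src i" "origin e a \<noteq> Enc i" "origin e a \<noteq> Coord"
    "origin e a \<noteq> Snk i"
  using origin_cases[of e a] by auto

lemma nbrs_trivial: "nbrs (Src i) = {Src i}" "nbrs (Enc i) = {Enc i}" "nbrs Coord = {Coord}"
    "nbrs (Snk i) = {Snk i}"
  by (auto simp: nbrs_def adj_def dest: sym)

definition readers :: "vertex \<Rightarrow> vertex set" where
  "readers x = {Mem e |e a. a \<in> acc e \<and> origin e a = x}"

text \<open>By \<open>origin_access_unique\<close> an address determines the epoch reading it from
  \<open>x\<close>, so readers can be counted by addresses.\<close>

lemma readers_bound:
  assumes "finite S" "\<And>e a. a \<in> acc e \<Longrightarrow> origin e a = x \<Longrightarrow> a \<in> S"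
  shows "finite (readers x)" "card (readers x) \<le> card S"
proof -
  have "readers x \<subseteq> (\<lambda>a. Mem (THE e. a \<in> acc e \<and> origin e a = x)) ` S"
  proof
    fix y assume "y \<in> readers x"
    then obtain e a where y: "y = Mem e" "a \<in> acc e" "origin e a = x" by (auto simp: readers_def)
    have "(THE e. a \<in> acc e \<and> origin e a = x) = e"
      using y origin_access_unique by (intro the_equality) auto
    then show "y \<in> (\<lambda>a. Mem (THE e. a \<in> acc e \<and> origin e a = x)) ` S"
      using y assms(2) by (intro image_eqI[of _ _ a]) auto
  qed
  then show "finite (readers x)" "card (readers x) \<le> card S"
    using assms(1) by (auto intro: finite_surj surj_card_le)
qed

lemma card_Un3_le: "card (A1 \<union> A2 \<union> A3) \<le> card A1 + card A2 + card A3"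
  by (meson add_le_mono1 card_Un_le le_trans)

text \<open>An input block meets at most five blocks in its vicinity and one reader. A memory node
  meets its two neighbours in time, the origins of at most \<open>K\<close> accessed blocks, and at
  most \<open>K\<close> readers. The factor 8 is a crude common bound for \<open>7\<close> and
  \<open>3 + K + K\<close>.\<close>

lemma nbrs_bound: "finite (nbrs x) \<and> card (nbrs x) \<le> 8 * K"
proof (cases x)
  case (Blk e a)
  have r: "finite (readers x)" "card (readers x) \<le> 1"
    using readers_bound[of "{a}" x] Blk origin_eq_Blk by auto
  have sub: "nbrs x \<subseteq> {x} \<union> Blk 0 ` {a - 2..a + 2} \<union> readers x"
    unfolding nbrs_def adj_def readers_def Blk by (auto simp: image_iff)
  have "card (Blk 0 ` {a - 2..a + 2}) \<le> 5"
    by (rule order.trans[OF card_image_le]) auto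
  then have "card ({x} \<union> Blk 0 ` {a - 2..a + 2} \<union> readers x) \<le> 7"
    using card_Un3_le[of "{x}" "Blk 0 ` {a - 2..a + 2}" "readers x"] r by simp
  then show ?thesis
    using card_mono[OF _ sub] finite_subset[OF sub] r K_pos by auto
next
  case (Mem e)
  have r: "finite (readers x)" "card (readers x) \<le> K"
    using readers_bound[of "acc e" x] Mem origin_eq_Mem card_acc_le[of e] by auto
  have sub: "nbrs x \<subseteq> {Mem e, Mem (e - 1), Mem (Suc e)} \<union> (\<lambda>a. origin e a) ` acc e \<union> readers x"
    unfolding nbrs_def adj_def readers_def Mem by (auto simp: image_iff)
  have "card ((\<lambda>a. origin e a) ` acc e) \<le> K"
    using card_image_le[of "acc e" "origin e"] card_acc_le[of e] by simp
  moreover have "card {Mem e, Mem (e - 1), Mem (Suc e)} \<le> 3"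
    by (simp add: card_insert_if)
  ultimately have "card ({Mem e, Mem (e - 1), Mem (Suc e)} \<union> (\<lambda>a. origin e a) ` acc e \<union> readers x) \<le> 3 + K + K"
    using card_Un3_le[of "{Mem e, Mem (e - 1), Mem (Suc e)}" "(\<lambda>a. origin e a) ` acc e" "readers x"] r
    by linarith
  then show ?thesis
    using card_mono[OF _ sub] finite_subset[OF sub] r K_pos by auto
qed (simp_all add: nbrs_trivial, use K_pos in auto)

section \<open>Balls and truncated distances\<close>

definition reach :: "vertex \<Rightarrow> nat \<Rightarrow> vertex set" where
  "reach x k = ((\<lambda>X. \<Union>(nbrs ` X)) ^^ k) {x}"

lemma reach_Suc: "y \<in> reach x k \<Longrightarrow> z \<in> nbrs y \<Longrightarrow> z \<in> reach x (Suc k)"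
  by (auto simp: reach_def)

lemma reach_mono: "k \<le> k' \<Longrightarrow> reach x k \<subseteq> reach x k'"
  by (induction k' rule: dec_induct) (auto intro: reach_Suc simp: nbrs_def)

lemma centre_in_reach: "x \<in> reach x k"
  using reach_mono[of 0 k x] by (auto simp: reach_def)

lemma finite_reach: "finite (reach x k)" and card_reach: "card (reach x k) \<le> (8 * K) ^ k"
  using card_iterated_nbrs_le[of nbrs "8 * K" k x] nbrs_bound by (auto simp: reach_def)

text \<open>The distance from \<open>x\<close>, cut off at \<open>h\<close>.\<close>

definition potential :: "nat \<Rightarrow> vertex \<Rightarrow> vertex \<Rightarrow> real" where
  "potential h x y = card {k. k < h \<and> y \<notin> reach x k}"

lemma potential_nbrs: "z \<in> nbrs y \<Longrightarrow> potential h x z \<le> potential h x y + 1"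
proof -
  assume z: "z \<in> nbrs y"
  have "{k. k < h \<and> z \<notin> reach x k} \<subseteq> insert 0 (Suc ` {k. k < h \<and> y \<notin> reach x k})"
  proof
    fix k assume "k \<in> {k. k < h \<and> z \<notin> reach x k}"
    then show "k \<in> insert 0 (Suc ` {k. k < h \<and> y \<notin> reach x k})"
      using reach_Suc[OF _ z] by (cases k) auto
  qed
  then have "card {k. k < h \<and> z \<notin> reach x k} \<le> card (insert 0 (Suc ` {k. k < h \<and> y \<notin> reach x k}))"
    by (intro card_mono) auto
  also have "\<dots> \<le> card {k. k < h \<and> y \<notin> reach x k} + 1"
    by (simp add: card_insert_if card_image)
  finally show ?thesis by (simp add: potential_def)
qed

lemma potential_lipschitz: "z \<in> nbrs y \<Longrightarrow> \<bar>potential h x z - potential h x y\<bar> \<le> 1"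
  using potential_nbrs[of z y h x] potential_nbrs[OF nbrs_sym, of z y h x] by linarith

lemma potential_centre: "potential h x x = 0"
  by (simp add: potential_def centre_in_reach)

lemma potential_le: "potential h x y \<le> h"
  using card_mono[of "{..<h}" "{k. k < h \<and> y \<notin> reach x k}"] by (auto simp: potential_def)

lemma potential_nonneg: "0 \<le> potential h x y"
  by (simp add: potential_def)

lemma potential_far: "y \<notin> reach x h \<Longrightarrow> potential h x y = h"
proof -
  assume "y \<notin> reach x h"
  then have "{k. k < h \<and> y \<notin> reach x k} = {..<h}" using reach_mono[of _ h x] by (auto dest: less_imp_le)
  then show ?thesis by (simp add: potential_def)
qed

text \<open>A memory node is the origin only of blocks that its epoch accessed, an initial block
  only of itself. This accounts for the factor \<open>K\<close> on top of the size of the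
  ball.\<close>

lemma card_origin_reach:
  "finite {a. origin e a \<in> reach x k} \<and> card {a. origin e a \<in> reach x k} \<le> (8 * K) ^ k * K"
proof -
  have fib: "finite {a. origin e a = y} \<and> card {a. origin e a = y} \<le> K" for y
  proof -
    obtain S where "{a. origin e a = y} \<subseteq> S" "finite S" "card S \<le> K"
    proof (cases y)
      case (Blk e' a)
      then show ?thesis using K_pos that[of "{a}"] origin_eq_Blk by auto
    next
      case (Mem e')
      then show ?thesis using card_acc_le[of e'] that[of "acc e'"] origin_eq_Mem by auto
    qed (rule that[of "{}"]; simp)+
    then show ?thesis using card_mono finite_subset by (metis order.trans)
  qed
  have eq: "{a. origin e a \<in> reach x k} = (\<Union>y\<in>reach x k. {a. origin e a = y})" by auto
  have "card (\<Union>y\<in>reach x k. {a. origin e a = y}) \<le> (\<Sum>y\<in>reach x k. card {a. origin e a = y})"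
    by (intro card_UN_le finite_reach)
  also have "\<dots> \<le> card (reach x k) * K"
    using sum_bounded_above[of "reach x k" "\<lambda>y. card {a. origin e a = y}" K] fib by simp
  also have "\<dots> \<le> (8 * K) ^ k * K" using card_reach by simp
  finally show ?thesis using fib finite_reach by (auto simp: eq)
qed

text \<open>Each pair of an epoch and a block it accesses is charged to one I/O of that epoch;
  repeated accesses in the same epoch are merged.\<close>

lemma sum_card_acc_le:
  assumes "\<And>\<tau>. t \<le> \<tau> \<Longrightarrow> p \<tau> = None"
  shows "(\<Sum>e<E. card (acc e)) \<le> t"
proof -
  let ?f = "\<lambda>\<rho>. (\<rho> div K, case p \<rho> of Some (Read a) \<Rightarrow> a | Some (Write a) \<Rightarrow> a | None \<Rightarrow> 0)"
  have "(SIGMA e:{..<E}. acc e) \<subseteq> ?f ` {..<t}"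
  proof clarify
    fix e a assume "a \<in> acc e"
    then obtain \<rho> where \<rho>: "e * K \<le> \<rho>" "\<rho> < Suc e * K" "p \<rho> = Some (Read a) \<or> p \<rho> = Some (Write a)"
      by (auto simp: acc_def accessed_def)
    have "\<rho> div K = e" using \<rho> by (intro div_nat_eqI) (auto simp: mult.commute)
    moreover have "\<rho> < t" using \<rho>(3) assms[of \<rho>] by (cases "\<rho> < t") auto
    ultimately show "(e, a) \<in> ?f ` {..<t}" using \<rho> by (intro image_eqI[of _ _ \<rho>]) auto
  qed
  then have "card (SIGMA e:{..<E}. acc e) \<le> card {..<t}" by (rule surj_card_le[rotated]) simp
  then show ?thesis by simp
qed

end

section \<open>The network of a run\<close>

lemma card_bits_length: "card {xs :: bits. length xs = l} = 2 ^ l" "finite {xs :: bits. length xs = l}"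
  using card_lists_length_eq[of "UNIV :: bool set" l] finite_lists_length_eq[of "UNIV :: bool set" l]
  by simp_all

lemma shannon_entropy_bits_le:
  assumes "finite \<Omega>" "\<Omega> \<noteq> {}" "\<And>x. x \<in> \<Omega> \<Longrightarrow> \<exists>s. X x = Some s \<and> length (s :: bits) = l"
  shows "shannon_entropy (uniform_count_measure \<Omega>) X \<le> l"
proof -
  have "X ` \<Omega> \<subseteq> Some ` {xs. length xs = l}" using assms(3) by (force simp: image_iff)
  from shannon_entropy_le_log_card[OF assms(1,2) this] show ?thesis
    by (simp add: card_image card_bits_length log_nat_power)
qed

text \<open>Cross entropy with the code that spends one bit on \<open>None\<close> and
  \<open>Suc w\<close> bits on a word: rare corrections cost little more than their flag.\<close>

lemma shannon_entropy_correction_le: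
  assumes fin: "finite \<Omega>" "\<Omega> \<noteq> {}"
    and X: "\<And>x s. x \<in> \<Omega> \<Longrightarrow> X x = Some s \<Longrightarrow> length (s :: bits) = w"
  shows "shannon_entropy (uniform_count_measure \<Omega>) X \<le>
    1 + real (card {x \<in> \<Omega>. X x \<noteq> None}) / card \<Omega> * w"
proof -
  let ?Y = "insert None (Some ` {xs :: bits. length xs = w})"
  define q :: "bits option \<Rightarrow> real" where "q y = (if y = None then 1 / 2 else 1 / 2 ^ Suc w)" for y
  have N: "card \<Omega> > 0" using fin by (simp add: card_gt_0_iff)
  have "X x \<in> ?Y" if "x \<in> \<Omega>" for x using X[OF that] by (cases "X x") auto
  then have sub: "X ` \<Omega> \<subseteq> ?Y" by (rule image_subsetI)
  have "(\<Sum>y\<in>X ` \<Omega>. q y) \<le> (\<Sum>y\<in>?Y. q y)"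
    by (rule sum_mono2[OF _ sub]) (auto simp: card_bits_length q_def)
  also have "\<dots> = q None + (\<Sum>s | length s = w. q (Some s))"
    by (simp add: card_bits_length image_iff sum.reindex)
  also have "\<dots> = 1" by (simp add: q_def card_bits_length)
  finally have "shannon_entropy (uniform_count_measure \<Omega>) X \<le> (\<Sum>x\<in>\<Omega>. - log 2 (q (X x))) / card \<Omega>"
    by (intro shannon_entropy_le_cross_entropy[OF fin]) (auto simp: q_def)
  also have "(\<Sum>x\<in>\<Omega>. - log 2 (q (X x))) = (\<Sum>x\<in>\<Omega>. 1 + real w * of_bool (X x \<noteq> None))"
  proof (rule sum.cong[OF refl])
    fix x show "- log 2 (q (X x)) = 1 + real w * of_bool (X x \<noteq> None)"
      using log_nat_power[of 2 2 w] by (auto simp: q_def log_divide log_mult)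
  qed
  also have "\<dots> = card \<Omega> + w * card {x \<in> \<Omega>. X x \<noteq> None}"
    using fin by (simp add: sum.distrib sum_distrib_left[symmetric] sum.inter_filter[symmetric] of_bool_def)
  finally show ?thesis using N by (simp add: field_simps)
qed

lemma sum_Un_le:
  fixes f :: "'a \<Rightarrow> real"
  assumes "finite X" "finite Y" "\<And>x. 0 \<le> f x"
  shows "sum f (X \<union> Y) \<le> sum f X + sum f Y"
  using sum.union_inter[OF assms(1,2), of f] sum_nonneg[of "X \<inter> Y" f] assms(3) by simp

locale oblivious_run = epochs p K for p K +
  fixes n w B M t :: nat and A :: em_alg
  assumes n_pos: "1 \<le> n" and w_pos: "1 \<le> w" and B_pos: "1 \<le> B" and B_le_M: "B \<le> M"
    and lg_le: "lg_ceil n \<le> w"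
    and alg: "em_algorithm (M * w) (B * w) A"
    and pattern: "\<And>\<pi> d. valid_input n w \<pi> d \<Longrightarrow> access_pattern A (input_disk n w B \<pi> d) = p"
    and halt: "\<And>\<tau>. p \<tau> = None \<longleftrightarrow> t \<le> \<tau>"
begin

text \<open>Halting occupies step \<open>t\<close>, so the final disk is certain only at times
  beyond \<open>t\<close>; this is the first epoch boundary strictly beyond it.\<close>

definition last_epoch :: nat where
  "last_epoch = Suc (t div K)"

lemma t_less: "t < last_epoch * K"
  using K_pos by (simp add: last_epoch_def dividend_less_times_div mult.commute)

text \<open>The network must be finite, so only blocks that are ever accessed are kept, together
  with a range covering the output array, from which the sinks read.\<close>

definition addresses :: "nat set" where
  "addresses = accessed p 0 (last_epoch * K) \<union> {output_base n w B..output_base n w B + n}"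

lemma finite_addresses [simp]: "finite addresses"
  by (simp add: addresses_def)

lemma acc_subset_addresses: "e < last_epoch \<Longrightarrow> acc e \<subseteq> addresses"
  using accessed_mono[of 0 "e * K" "Suc e * K" "last_epoch * K" p] mult_le_mono1[of "Suc e" last_epoch K]
  by (auto simp: addresses_def acc_def simp del: mult_Suc)

definition output_block :: "nat \<Rightarrow> nat" where
  "output_block j = output_base n w B + (j - 1) div B"

lemma output_block_address: "j \<in> {1..n} \<Longrightarrow> output_block j \<in> addresses"
  using div_le_dividend[of "j - 1" B] by (auto simp: output_block_def addresses_def simp del: div_le_dividend)

lemma card_output_block_vimage: "card {j \<in> {1..n}. output_block j = a} \<le> B"
proof -
  let ?c = "a - output_base n w B"
  have "{j \<in> {1..n}. output_block j = a} \<subseteq> Suc ` {?c * B..<?c * B + B}"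
  proof
    fix j assume "j \<in> {j \<in> {1..n}. output_block j = a}"
    then have j: "1 \<le> j" "(j - 1) div B = ?c" by (auto simp: output_block_def)
    have "?c * B \<le> j - 1" "j - 1 < ?c * B + B"
      using B_pos div_times_less_eq_dividend[of "j - 1" B] dividend_less_div_times[of B "j - 1"]
      unfolding j(2) by auto
    then show "j \<in> Suc ` {?c * B..<?c * B + B}" using j(1) by (intro image_eqI[of _ _ "j - 1"]) auto
  qed
  then have "card {j \<in> {1..n}. output_block j = a} \<le> card {?c * B..<?c * B + B}"
    by (rule surj_card_le[rotated]) simp
  then show ?thesis by simp
qed

lemma card_vimage_output_block_le:
  assumes "finite X"
  shows "card {j \<in> {1..n}. output_block j \<in> X} \<le> B * card X"
proof -
  have eq: "{j \<in> {1..n}. output_block j \<in> X} = (\<Union>a\<in>X. {j \<in> {1..n}. output_block j = a})" by auto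
  have "card {j \<in> {1..n}. output_block j \<in> X} \<le> (\<Sum>a\<in>X. card {j \<in> {1..n}. output_block j = a})"
    unfolding eq by (rule card_UN_le[OF assms])
  also have "\<dots> \<le> B * card X"
    using sum_bounded_above[of X "\<lambda>a. card {j \<in> {1..n}. output_block j = a}" B]
      card_output_block_vimage by (simp add: mult.commute)
  finally show ?thesis .
qed

definition start :: "nat \<Rightarrow> vertex" where
  "start i = Blk 0 (first_block n w B i)"

text \<open>Consists of target words and is free of \<open>\<pi>\<close>, so that a random
  permutation meets a fixed small set for every entry.\<close>

definition near :: "nat \<Rightarrow> nat \<Rightarrow> nat set" where
  "near h i = {j \<in> {1..n}. origin last_epoch (output_block j) \<in> reach (start i) h}"

lemma card_near_le: "card (near h i) \<le> B * ((8 * K) ^ h * K)"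
proof -
  let ?X = "{a. origin last_epoch a \<in> reach (start i) h}"
  have "card (near h i) \<le> B * card ?X"
    using card_vimage_output_block_le[of ?X] card_origin_reach[of last_epoch "start i" h]
    by (simp add: near_def)
  also have "\<dots> \<le> B * ((8 * K) ^ h * K)"
    using card_origin_reach[of last_epoch "start i" h] by (intro mult_le_mono2) blast
  finally show ?thesis .
qed

abbreviation words :: "(nat \<Rightarrow> nat) set" where
  "words \<equiv> PiE {..<n} (\<lambda>_. {..<2 ^ w})"

lemma words_finite: "finite words" "words \<noteq> {}"
  by (auto simp: PiE_eq_empty_iff lessThan_empty_iff intro!: finite_PiE)

text \<open>The permutation problem counts entries from 1, the k-pairs instance from 0; hence the
  shift.\<close>

definition data :: "(nat \<Rightarrow> nat) \<Rightarrow> nat \<Rightarrow> bits" where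
  "data x i = binary w (x (i - 1))"

lemma length_data [simp]: "length (data x i) = w"
  by (simp add: data_def)

end

text \<open>Whatever the sources receive, the simulated run works on \<open>\<nu> x\<close>, where
  the algorithm is right. The code is therefore free of errors although the algorithm is
  not.\<close>

locale coded_run = oblivious_run +
  fixes \<pi> :: "nat \<Rightarrow> nat" and \<nu> :: "(nat \<Rightarrow> nat) \<Rightarrow> nat \<Rightarrow> nat"
  assumes perm: "\<pi> permutes {1..n}"
    and \<nu>_words: "\<And>x. \<nu> x \<in> words"
    and \<nu>_correct: "\<And>x. permutes_correctly n w B \<pi> (data (\<nu> x)) A"
begin

abbreviation disk :: "(nat \<Rightarrow> nat) \<Rightarrow> disk" where
  "disk x \<equiv> input_disk n w B \<pi> (data x)"

definition mem :: "(nat \<Rightarrow> nat) \<Rightarrow> nat \<Rightarrow> bits option" where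
  "mem x e = fst (em_run A (disk x) (e * K))"

definition blk :: "(nat \<Rightarrow> nat) \<Rightarrow> nat \<Rightarrow> nat \<Rightarrow> bits" where
  "blk x e a = snd (em_run A (disk x) (e * K)) a"

lemma pattern_disk: "access_pattern A (disk x) = p"
  using perm by (intro pattern) (simp add: valid_input_def)

lemma length_disk: "length (disk x a) = B * w"
  by (simp add: input_disk_def)

lemma length_blk: "length (blk x e a) = B * w"
  unfolding blk_def by (rule em_run_block_length[OF alg length_disk])

lemma mem_Some: "e < last_epoch \<Longrightarrow> \<exists>s. mem x e = Some s \<and> length s = M * w"
proof -
  assume "e < last_epoch"
  then have "e \<le> t div K" by (simp add: last_epoch_def)
  then have "e * K \<le> t" by (meson div_times_less_eq_dividend le_trans mult_le_mono1)
  then obtain s where "mem x e = Some s"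
    using em_run_Some[of A "disk x" t "e * K"] halt by (auto simp: pattern_disk mem_def)
  moreover from this have "length s = M * w"
    unfolding mem_def by (rule em_run_mem_length[OF alg length_disk])
  ultimately show ?thesis by blast
qed

lemma blk_Suc_unaccessed: "a \<notin> acc e \<Longrightarrow> blk x (Suc e) a = blk x e a"
  unfolding blk_def by (rule em_run_unaccessed) (auto simp: pattern_disk acc_def)

lemma epoch_cong:
  assumes "mem x e = mem y e" "\<And>a. a \<in> acc e \<Longrightarrow> blk x e a = blk y e a"
  shows "mem x (Suc e) = mem y (Suc e)" "a \<in> acc e \<Longrightarrow> blk x (Suc e) a = blk y (Suc e) a"
  using em_run_accessed_cong[of A "disk x" "disk y" "e * K" "Suc e * K"] assms
  by (auto simp: pattern_disk mem_def blk_def acc_def simp del: mult_Suc)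

lemma blk_0_cong:
  assumes "\<And>i. i < n \<Longrightarrow> first_block n w B i \<le> a \<Longrightarrow> a \<le> first_block n w B i + 2 \<Longrightarrow> binary w (x i) = binary w (y i)"
  shows "blk x 0 a = blk y 0 a"
  unfolding blk_def using w_pos B_pos lg_le assms
  by (simp add: input_disk_cong[of w B n "data x" "data y" a \<pi>] data_def)

lemma final_word:
  assumes "i < n"
  shows "take w (drop ((\<pi> (Suc i) - 1) mod B * w) (blk (\<nu> x) last_epoch (output_block (\<pi> (Suc i))))) =
    binary w (\<nu> x i)"
proof -
  obtain D where D: "halts_with A (disk (\<nu> x)) D"
    "\<forall>i\<in>{1..n}. output_word n w B D (\<pi> i) = data (\<nu> x) i"
    using \<nu>_correct[of x] by (auto simp: permutes_correctly_def)
  have "snd (em_run A (disk (\<nu> x)) (last_epoch * K)) = D"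
    by (rule em_run_final[OF _ t_less D(1)]) (simp add: pattern_disk halt)
  then show ?thesis using D(2)[rule_format, of "Suc i"] assms
    by (simp add: blk_def output_block_def output_word_def data_def)
qed

text \<open>The two corrections differ: an encoder must learn the word \<open>\<nu> x i\<close> that
  replaces its own, whereas the sink obtains \<open>\<nu> x i\<close> from the run and must learn
  the original \<open>x i\<close>. \<open>None\<close> means that the word was left alone.\<close>

fun msg :: "(nat \<Rightarrow> nat) \<Rightarrow> vertex \<times> vertex \<Rightarrow> bits option" where
  "msg x (Src i, _) = Some (binary w (x i))"
| "msg x (Coord, Enc i) = (if \<nu> x i = x i then None else Some (binary w (\<nu> x i)))"
| "msg x (Coord, Snk i) = (if \<nu> x i = x i then None else Some (binary w (x i)))"
| "msg x (Enc i, _) = Some (binary w (\<nu> x i))"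
| "msg x (Blk e a, _) = Some (blk (\<nu> x) e a)"
| "msg x (Mem e, Blk _ a) = Some (blk (\<nu> x) (Suc e) a)"
| "msg x (Mem e, Mem _) = mem (\<nu> x) (Suc e)"

definition correction_rate :: "nat \<Rightarrow> real" where
  "correction_rate i = real (card {x \<in> words. \<nu> x i \<noteq> x i}) / card words"

fun cap :: "vertex \<times> vertex \<Rightarrow> real" where
  "cap (Coord, Enc i) = 1 + correction_rate i * w"
| "cap (Coord, Snk i) = 1 + correction_rate i * w"
| "cap (Blk _ _, _) = B * w"
| "cap (Mem _, Blk _ _) = B * w"
| "cap (Mem _, Mem _) = M * w"
| "cap _ = w"

text \<open>
  A path through the coordinator has length at least \<open>h / 2 + h / 2\<close>, so it is no shortcut; on the
  other hand the capacity into the coordinator accounts for only half of the demand times \<open>h\<close>.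
\<close>

fun len :: "nat \<Rightarrow> vertex \<times> vertex \<Rightarrow> real" where
  "len h (Src _, Coord) = h / 2"
| "len h (Coord, _) = h / 2"
| "len h (Enc _, Blk _ _) = 1"
| "len h (Blk _ _, Mem _) = 1"
| "len h (Mem _, Mem _) = 1"
| "len h _ = 0"

fun rank :: "vertex \<Rightarrow> nat" where
  "rank (Src _) = 0"
| "rank Coord = 1"
| "rank (Enc _) = 2"
| "rank (Blk e _) = 3 + 2 * e"
| "rank (Mem e) = 4 + 2 * e"
| "rank (Snk _) = 4 + 2 * last_epoch"

text \<open>Edges that keep an idle block exist in every epoch and can far outnumber the I/Os, so
  they must have length 0. Accordingly a block takes the position of its origin.\<close>

fun node :: "vertex \<Rightarrow> vertex" where
  "node (Src i) = start i"
| "node (Enc i) = start i"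
| "node (Blk e a) = origin e a"
| "node (Snk i) = origin last_epoch (output_block (\<pi> (Suc i)))"
| "node v = v"

definition E_up where "E_up = (\<lambda>i. (Src i, Coord)) ` {..<n}"
definition E_src where "E_src = (\<lambda>i. (Src i, Enc i)) ` {..<n}"
definition E_enc where "E_enc = (\<lambda>i. (Coord, Enc i)) ` {..<n}"
definition E_snk where "E_snk = (\<lambda>i. (Coord, Snk i)) ` {..<n}"
definition E_in where "E_in = (\<lambda>(i, a). (Enc i, Blk 0 a)) `
  (SIGMA i:{..<n}. addresses \<inter> {first_block n w B i..first_block n w B i + 2})"
definition E_keep where "E_keep = (\<lambda>(e, a). (Blk e a, Blk (Suc e) a)) `
  (SIGMA e:{..<last_epoch}. addresses - acc e)"
definition E_read where "E_read = (\<lambda>(e, a). (Blk e a, Mem e)) ` (SIGMA e:{..<last_epoch}. acc e)"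
definition E_write where "E_write = (\<lambda>(e, a). (Mem e, Blk (Suc e) a)) ` (SIGMA e:{..<last_epoch}. acc e)"
text \<open>Stops short of \<open>last_epoch\<close>: there the run has halted and no memory
  contents remain to be passed on.\<close>

definition E_mem where "E_mem = (\<lambda>e. (Mem e, Mem (Suc e))) ` {..<t div K}"
definition E_out where "E_out = (\<lambda>i. (Blk last_epoch (output_block (\<pi> (Suc i))), Snk i)) ` {..<n}"

definition E where
  "E = E_up \<union> (E_src \<union> (E_enc \<union> (E_snk \<union> (E_in \<union> (E_keep \<union> (E_read \<union> (E_write \<union> (E_mem \<union> E_out))))))))"

lemmas E_defs = E_up_def E_src_def E_enc_def E_snk_def E_in_def E_keep_def E_read_def E_write_def
  E_mem_def E_out_def

lemma finite_E: "finite E_up" "finite E_src" "finite E_enc" "finite E_snk" "finite E_in"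
  "finite E_keep" "finite E_read" "finite E_write" "finite E_mem" "finite E_out"
  unfolding E_defs by (intro finite_imageI finite_SigmaI; simp)+

lemma E_memI:
  "i < n \<Longrightarrow> (Src i, Coord) \<in> E"
  "i < n \<Longrightarrow> (Src i, Enc i) \<in> E"
  "i < n \<Longrightarrow> (Coord, Enc i) \<in> E"
  "i < n \<Longrightarrow> (Coord, Snk i) \<in> E"
  "i < n \<Longrightarrow> a \<in> addresses \<Longrightarrow> first_block n w B i \<le> a \<Longrightarrow> a \<le> first_block n w B i + 2 \<Longrightarrow> (Enc i, Blk 0 a) \<in> E"
  "e < last_epoch \<Longrightarrow> a \<in> addresses \<Longrightarrow> a \<notin> acc e \<Longrightarrow> (Blk e a, Blk (Suc e) a) \<in> E"
  "e < last_epoch \<Longrightarrow> a \<in> acc e \<Longrightarrow> (Blk e a, Mem e) \<in> E"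
  "e < last_epoch \<Longrightarrow> a \<in> acc e \<Longrightarrow> (Mem e, Blk (Suc e) a) \<in> E"
  "Suc e < last_epoch \<Longrightarrow> (Mem e, Mem (Suc e)) \<in> E"
  "i < n \<Longrightarrow> (Blk last_epoch (output_block (\<pi> (Suc i))), Snk i) \<in> E"
  by (auto simp: E_def E_defs last_epoch_def image_iff)

lemma E_cases:
  assumes "(u, v) \<in> E"
  obtains (up) i where "u = Src i" "v = Coord" "i < n"
  | (src) i where "u = Src i" "v = Enc i" "i < n"
  | (enc) i where "u = Coord" "v = Enc i" "i < n"
  | (snk) i where "u = Coord" "v = Snk i" "i < n"
  | (inp) i a where "u = Enc i" "v = Blk 0 a" "i < n" "a \<in> addresses"
      "first_block n w B i \<le> a" "a \<le> first_block n w B i + 2"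
  | (keep) e a where "u = Blk e a" "v = Blk (Suc e) a" "e < last_epoch" "a \<in> addresses" "a \<notin> acc e"
  | (rd) e a where "u = Blk e a" "v = Mem e" "e < last_epoch" "a \<in> acc e"
  | (wr) e a where "u = Mem e" "v = Blk (Suc e) a" "e < last_epoch" "a \<in> acc e"
  | (mm) e where "u = Mem e" "v = Mem (Suc e)" "Suc e < last_epoch"
  | (out) i where "u = Blk last_epoch (output_block (\<pi> (Suc i)))" "v = Snk i" "i < n"
  using assms unfolding E_def E_defs last_epoch_def by auto


section \<open>Every message is computable at its tail, and every sink decodes\<close>

lemma words_less: "x \<in> words \<Longrightarrow> i < n \<Longrightarrow> x i < 2 ^ w"
  by (auto simp: PiE_iff)

lemma binary_eq_iff: "x \<in> words \<Longrightarrow> y \<in> words \<Longrightarrow> i < n \<Longrightarrow> binary w (x i) = binary w (y i) \<longleftrightarrow> x i = y i"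
  using inj_on_binary[of w] words_less[of x i] words_less[of y i] by (auto simp: inj_on_def)

lemma rank_E: "(u, v) \<in> E \<Longrightarrow> rank u < rank v"
  by (cases rule: E_cases) auto

text \<open>The coordinator knows all of \<open>x\<close>, hence \<open>\<nu> x\<close>. An encoder
  combines its own word with the correction, an initial block is filled by the entries meeting it, a
  later one is copied or written back, and a memory node replays its epoch by
  \<open>epoch_cong\<close>.\<close>

lemma msg_determined:
  assumes "(u, v) \<in> E" and x: "x \<in> words" and y: "y \<in> words"
    and src: "\<And>i. i < n \<Longrightarrow> Src i = u \<Longrightarrow> x i = y i"
    and inp: "\<And>z. (z, u) \<in> E \<Longrightarrow> msg x (z, u) = msg y (z, u)"
  shows "msg x (u, v) = msg y (u, v)"
proof -
  have coord: "msg x (u, v) = msg y (u, v)" if "u = Coord"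
  proof -
    have "x i = y i" if "i < n" for i
      using inp[of "Src i"] E_memI(1)[OF that] that binary_eq_iff[OF x y that] \<open>u = Coord\<close> by simp
    then have "x = y" using x y by (intro PiE_ext) auto
    then show ?thesis by simp
  qed
  have blk_eq: "blk (\<nu> x) e a = blk (\<nu> y) e a" if ue: "u = Blk e a" and a: "a \<in> addresses" and e: "e \<le> last_epoch" for e a
  proof (cases e)
    case 0
    have "binary w (\<nu> x i) = binary w (\<nu> y i)"
      if "i < n" "first_block n w B i \<le> a" "a \<le> first_block n w B i + 2" for i
      using inp[of "Enc i"] E_memI(5)[OF that(1) a that(2,3)] ue 0 by simp
    then show ?thesis using blk_0_cong[of a "\<nu> x" "\<nu> y"] 0 by blast
  next
    case (Suc e')
    then have e': "e' < last_epoch" using e by simp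
    show ?thesis
    proof (cases "a \<in> acc e'")
      case True
      then show ?thesis using inp[of "Mem e'"] E_memI(8)[OF e' True] ue Suc by simp
    next
      case False
      then show ?thesis
        using inp[of "Blk e' a"] E_memI(6)[OF e' a False] ue Suc by (simp add: blk_Suc_unaccessed)
    qed
  qed
  have mem_eq: "mem (\<nu> x) (Suc e) = mem (\<nu> y) (Suc e) \<and> (\<forall>a\<in>acc e. blk (\<nu> x) (Suc e) a = blk (\<nu> y) (Suc e) a)"
    if ue: "u = Mem e" and e: "e < last_epoch" for e
  proof -
    have "mem (\<nu> x) e = mem (\<nu> y) e"
    proof (cases e)
      case 0
      then show ?thesis by (simp add: mem_def)
    next
      case (Suc e')
      then show ?thesis using inp[of "Mem e'"] E_memI(9)[of e'] e ue by simp
    qed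
    moreover have "blk (\<nu> x) e a = blk (\<nu> y) e a" if "a \<in> acc e" for a
      using inp[of "Blk e a"] E_memI(7)[OF e that] ue by simp
    ultimately show ?thesis using epoch_cong by blast
  qed
  have out_address: "output_block (\<pi> (Suc i)) \<in> addresses" if "i < n" for i
    using that permutes_in_image[OF perm, of "Suc i"] by (intro output_block_address) auto
  show ?thesis
  using assms(1)
  proof (cases rule: E_cases)
    case (inp i a)
    have xi: "x i = y i"
      using assms(5)[of "Src i"] E_memI(2)[of i] inp binary_eq_iff[OF x y] by simp
    have "msg x (Coord, Enc i) = msg y (Coord, Enc i)"
      using assms(5)[of Coord] E_memI(3)[of i] inp by simp
    then have "binary w (\<nu> x i) = binary w (\<nu> y i)"
      using xi by (auto split: if_splits)
    then show ?thesis using inp by simp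
  next
    case (rd e a)
    then show ?thesis using blk_eq acc_subset_addresses[of e] by auto
  next
    case (out i)
    then show ?thesis using blk_eq[OF _ out_address[of i]] by simp
  next
    case (wr e a)
    then show ?thesis using mem_eq[of e] by simp
  next
    case (mm e)
    then show ?thesis using mem_eq[of e] by simp
  next
    case (keep e a)
    then show ?thesis using blk_eq[of e a] by simp
  qed (use coord src in auto)
qed

lemma sink_decodes:
  assumes i: "i < n" and x: "x \<in> words" and y: "y \<in> words"
    and inp: "\<And>z. (z, Snk i) \<in> E \<Longrightarrow> msg x (z, Snk i) = msg y (z, Snk i)"
  shows "x i = y i"
proof -
  have "blk (\<nu> x) last_epoch (output_block (\<pi> (Suc i))) = blk (\<nu> y) last_epoch (output_block (\<pi> (Suc i)))"
    using inp[OF E_memI(10)[OF i]] by simp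
  then have "binary w (\<nu> x i) = binary w (\<nu> y i)"
    using final_word[OF i, of x] final_word[OF i, of y] by simp
  then have "\<nu> x i = \<nu> y i" using binary_eq_iff[OF \<nu>_words \<nu>_words i] by simp
  moreover have "msg x (Coord, Snk i) = msg y (Coord, Snk i)" using inp[OF E_memI(4)[OF i]] .
  ultimately show ?thesis using binary_eq_iff[OF x y i] by (auto split: if_splits)
qed

section \<open>Entropies, lengths and the total cost of the network\<close>

lemma correction_rate_nonneg: "0 \<le> correction_rate i"
  by (simp add: correction_rate_def)

lemma entropy_msg_le:
  assumes "e \<in> E"
  shows "shannon_entropy (uniform_count_measure words) (\<lambda>x. msg x e) \<le> cap e"
proof -
  obtain u v where e: "e = (u, v)" by (cases e)
  have bits: "shannon_entropy (uniform_count_measure words) (\<lambda>x. msg x e) \<le> l"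
    if "\<And>x. \<exists>s. msg x e = Some s \<and> length s = l" for l
    using that by (intro shannon_entropy_bits_le words_finite)
  have corr: "shannon_entropy (uniform_count_measure words) (\<lambda>x. msg x e) \<le> 1 + correction_rate i * w"
    if "\<And>x. msg x e = None \<longleftrightarrow> \<nu> x i = x i" "\<And>x s. msg x e = Some s \<Longrightarrow> length s = w" for i
    using shannon_entropy_correction_le[OF words_finite, of "\<lambda>x. msg x e" w] that
    by (simp add: correction_rate_def)
  from assms[unfolded e] show ?thesis
  proof (cases rule: E_cases)
    case (enc i)
    have "msg x e = None \<longleftrightarrow> \<nu> x i = x i" "msg x e = Some s \<Longrightarrow> length s = w" for x s
      using enc by (auto simp: e split: if_splits)
    from corr[OF this] show ?thesis using enc by (simp add: e)
  next
    case (snk i)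
    have "msg x e = None \<longleftrightarrow> \<nu> x i = x i" "msg x e = Some s \<Longrightarrow> length s = w" for x s
      using snk by (auto simp: e split: if_splits)
    from corr[OF this] show ?thesis using snk by (simp add: e)
  next
    case (mm k)
    then show ?thesis using bits[of "M * w"] mem_Some[of "Suc k"] by (simp add: e)
  qed (use bits in \<open>auto simp: e length_blk simp del: of_nat_mult\<close>)
qed

lemma cap_pos: "e \<in> E \<Longrightarrow> 0 < cap e"
proof -
  have "1 + correction_rate i * w > 0" for i
    using correction_rate_nonneg[of i] by (simp add: add_pos_nonneg)
  then show "e \<in> E \<Longrightarrow> 0 < cap e"
    using w_pos B_pos B_le_M by (cases e rule: cap.cases) auto
qed

text \<open>All other potentials lie between 0 and \<open>h\<close>. Placing the coordinator
  halfway, for every pair alike, lets each of its edges make do with length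
  \<open>h / 2\<close>.\<close>

definition \<phi> :: "nat \<Rightarrow> nat \<Rightarrow> vertex \<Rightarrow> real" where
  "\<phi> h i v = (if v = Coord then h / 2 else potential h (start i) (node v))"

lemma \<phi>_lipschitz:
  assumes "(u, v) \<in> E"
  shows "\<bar>\<phi> h i v - \<phi> h i u\<bar> \<le> len h (u, v)"
proof -
  have half: "\<bar>potential h x y - h / 2\<bar> \<le> h / 2" "\<bar>h / 2 - potential h x y\<bar> \<le> h / 2" for x y
    using potential_le[of h x y] potential_nonneg[of h x y] by (intro abs_leI; linarith)+
  have half': "\<bar>potential h x y - h / 2\<bar> * 2 \<le> h" "\<bar>h / 2 - potential h x y\<bar> * 2 \<le> h" for x y
    using half[of x y] by (simp_all only: abs_le_iff) (auto simp: abs_if)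
  have step: "\<bar>potential h (start i) z - potential h (start i) y\<bar> \<le> 1" if "(y, z) \<in> adj" for y z
    using that by (intro potential_lipschitz) (simp add: nbrs_def)
  from assms show ?thesis
  proof (cases rule: E_cases)
    case (inp j a)
    then have "(start j, Blk 0 a) \<in> adj" by (auto simp: adj_def start_def)
    from step[OF this] show ?thesis by (simp add: \<phi>_def inp)
  next
    case (rd e a)
    then have "(origin e a, Mem e) \<in> adj" by (auto simp: adj_def)
    from step[OF this] show ?thesis by (simp add: \<phi>_def rd)
  next
    case (mm e)
    then have "(Mem e, Mem (Suc e)) \<in> adj" by (auto simp: adj_def)
    from step[OF this] show ?thesis by (simp add: \<phi>_def mm)
  qed (auto simp: \<phi>_def half')
qed

lemma len_nonneg: "0 \<le> len h e"
  by (cases "(h, e)" rule: len.cases) auto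

lemma cap_nonneg: "0 \<le> cap e"
  using correction_rate_nonneg by (cases e rule: cap.cases) (auto simp: add_nonneg_nonneg)

text \<open>The terms stem in turn from the edges into the coordinator, its corrections (encoders
  and sinks contribute half each), the at most three input blocks per entry, the block reads, and
  the memory passed between epochs. All other edges have length 0.\<close>

lemma cost_le:
  "(\<Sum>e\<in>E. cap e * len h e) \<le> n * w * h / 2 + (\<Sum>i<n. 1 + correction_rate i * w) * h +
    3 * n * w + t * (B * w) + (t div K) * (M * w)"
proof -
  let ?f = "\<lambda>e. cap e * len h e"
  have nn: "0 \<le> ?f e" for e by (simp add: cap_nonneg len_nonneg)
  have "sum ?f E \<le> sum ?f E_up + (sum ?f E_src + (sum ?f E_enc + (sum ?f E_snk + (sum ?f E_in +
      (sum ?f E_keep + (sum ?f E_read + (sum ?f E_write + (sum ?f E_mem + sum ?f E_out))))))))"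
    unfolding E_def by (intro order.trans[OF sum_Un_le] add_left_mono finite_UnI finite_E nn order.refl)
  moreover have "sum ?f E_up = n * w * h / 2"
    unfolding E_up_def by (subst sum.reindex) (auto simp: inj_on_def)
  moreover have "sum ?f E_enc = (\<Sum>i<n. 1 + correction_rate i * w) * h / 2"
    unfolding E_enc_def by (subst sum.reindex) (auto simp: inj_on_def sum_distrib_right sum_divide_distrib)
  moreover have "sum ?f E_snk = (\<Sum>i<n. 1 + correction_rate i * w) * h / 2"
    unfolding E_snk_def by (subst sum.reindex) (auto simp: inj_on_def sum_distrib_right sum_divide_distrib)
  moreover have "sum ?f E_src = 0" "sum ?f E_keep = 0" "sum ?f E_write = 0" "sum ?f E_out = 0"
    unfolding E_defs by (auto intro!: sum.neutral)
  moreover have "sum ?f E_in \<le> 3 * n * w"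
  proof -
    have "card E_in \<le> card (SIGMA i:{..<n}. addresses \<inter> {first_block n w B i..first_block n w B i + 2})"
      unfolding E_in_def by (rule card_image_le) (intro finite_SigmaI; simp)
    also have "\<dots> \<le> (\<Sum>i<n. 3)"
    proof (subst card_SigmaI, simp, simp, rule sum_mono)
      fix i
      show "card (addresses \<inter> {first_block n w B i..first_block n w B i + 2}) \<le> 3"
        using card_mono[of "{first_block n w B i..first_block n w B i + 2}" "addresses \<inter> {first_block n w B i..first_block n w B i + 2}"]
        by auto
    qed
    finally have "real (card E_in) \<le> 3 * n" by (simp add: mult.commute flip: of_nat_mult)
    moreover have "sum ?f E_in = real (card E_in) * w"
    proof -
      have "sum ?f E_in = (\<Sum>e\<in>E_in. real w)" by (rule sum.cong) (auto simp: E_in_def)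
      then show ?thesis by simp
    qed
    ultimately show ?thesis by (simp add: mult_right_mono)
  qed
  moreover have "sum ?f E_read \<le> t * (B * w)"
  proof -
    have "card E_read \<le> card (SIGMA e:{..<last_epoch}. acc e)"
      unfolding E_read_def by (rule card_image_le) (intro finite_SigmaI; simp)
    also have "\<dots> \<le> t" using sum_card_acc_le[of t last_epoch] halt by simp
    finally have "real (card E_read) \<le> t" by simp
    moreover have "sum ?f E_read = real (card E_read) * (B * w)"
    proof -
      have "sum ?f E_read = (\<Sum>e\<in>E_read. real (B * w))" by (rule sum.cong) (auto simp: E_read_def)
      then show ?thesis by simp
    qed
    ultimately show ?thesis by (simp add: mult_right_mono)
  qed
  moreover have "sum ?f E_mem = (t div K) * (M * w)"
    unfolding E_mem_def by (subst sum.reindex) (auto simp: inj_on_def)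
  ultimately show ?thesis by (simp add: mult.commute[of "real h"])
qed

text \<open>A far pair has potential difference \<open>h\<close>, any other at least 0. The bound
  has force once clearly more than half of the entries are far, since \<open>n * w * h / 2\<close>
  is lost to the coordinator.\<close>

lemma network_bound:
  assumes "undirected_k_pairs_conjecture"
  shows "w * (h * card {i. i < n \<and> \<pi> (Suc i) \<notin> near h i}) \<le>
    n * w * h / 2 + (\<Sum>i<n. 1 + correction_rate i * w) * h + 3 * n * w + t * (B * w) + (t div K) * (M * w)"
proof -
  let ?far = "{i. i < n \<and> \<pi> (Suc i) \<notin> near h i}"
  have "h * card ?far = (\<Sum>i\<in>?far. real h)" by simp
  also have "\<dots> = (\<Sum>i\<in>?far. \<phi> h i (Snk i))"
  proof (rule sum.cong[OF refl])
    fix i assume "i \<in> ?far"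
    then have "origin last_epoch (output_block (\<pi> (Suc i))) \<notin> reach (start i) h"
      using permutes_in_image[OF perm, of "Suc i"] by (auto simp: near_def)
    then show "real h = \<phi> h i (Snk i)" by (simp add: \<phi>_def potential_far)
  qed
  also have "\<dots> \<le> (\<Sum>i<n. \<phi> h i (Snk i) - \<phi> h i (Src i))"
    by (rule order.trans[OF sum_mono2[of "{..<n}"]])
      (auto simp: \<phi>_def potential_nonneg potential_centre)
  finally have far: "real (h * card ?far) \<le> (\<Sum>i<n. \<phi> h i (Snk i) - \<phi> h i (Src i))" .
  have fE: "finite E" unfolding E_def by (intro finite_UnI finite_E)
  have "real w * (\<Sum>i<n. \<phi> h i (Snk i) - \<phi> h i (Src i)) \<le> (\<Sum>e\<in>E. cap e * len h e)"
  proof (rule k_pairs_potential_bound[OF assms, where V = "fst ` E \<union> snd ` E" and rank = rank and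
        S = "\<lambda>_. {..<2 ^ w}" and msg = msg])
    show "finite (fst ` E \<union> snd ` E)" using fE by simp
    show "E \<subseteq> (fst ` E \<union> snd ` E) \<times> (fst ` E \<union> snd ` E)"
    proof (rule subrelI)
      fix u v assume "(u, v) \<in> E"
      then have "fst (u, v) \<in> fst ` E" "snd (u, v) \<in> snd ` E" by (rule imageI)+
      then show "(u, v) \<in> (fst ` E \<union> snd ` E) \<times> (fst ` E \<union> snd ` E)" by simp
    qed
    show "Src i \<in> fst ` E \<union> snd ` E \<and> Snk i \<in> fst ` E \<union> snd ` E \<and> Src i \<noteq> Snk i" if "i < n" for i
      using imageI[OF E_memI(1)[OF that], of fst] imageI[OF E_memI(4)[OF that], of snd] by simp
    show "finite {..<2 ^ w :: nat} \<and> {..<2 ^ w :: nat} \<noteq> {}" by (auto simp: lessThan_empty_iff)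
    show "0 < real w" using w_pos by simp
    show "real w \<le> log 2 (card {..<2 ^ w :: nat})" by (simp add: log_nat_power)
    show "rank u < rank v" if "(u, v) \<in> E" for u v by (rule rank_E[OF that])
    show "0 < cap e" if "e \<in> E" for e by (rule cap_pos[OF that])
    show "msg x (u, v) = msg y (u, v)"
      if "(u, v) \<in> E" "x \<in> words" "y \<in> words" "\<And>i. i < n \<Longrightarrow> Src i = u \<Longrightarrow> x i = y i"
        "\<And>z. (z, u) \<in> E \<Longrightarrow> msg x (z, u) = msg y (z, u)" for u v x y
      by (rule msg_determined[OF that])
    show "x i = y i" if "i < n" "x \<in> words" "y \<in> words"
      "\<And>z. (z, Snk i) \<in> E \<Longrightarrow> msg x (z, Snk i) = msg y (z, Snk i)" for i x y
      by (rule sink_decodes[OF that])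
    show "shannon_entropy (uniform_count_measure words) (\<lambda>x. msg x e) \<le> cap e" if "e \<in> E" for e
      by (rule entropy_msg_le[OF that])
    show "\<bar>\<phi> h i v - \<phi> h i u\<bar> \<le> len h (u, v)" if "(u, v) \<in> E" for i u v
      by (rule \<phi>_lipschitz[OF that])
    show "0 \<le> len h e" for e by (rule len_nonneg)
  qed
  moreover have "w * (h * card ?far) \<le> real w * (\<Sum>i<n. \<phi> h i (Snk i) - \<phi> h i (Src i))"
    using mult_left_mono[OF far, of "real w"] by simp
  ultimately show ?thesis using cost_le[of h] by linarith
qed

end

section \<open>The lower bound\<close>

text \<open>Composing with a transposition shows that \<open>\<pi> i\<close> takes all values
  equally often.\<close>

lemma card_permutes_image_mem:
  assumes "i \<in> {1..n}" "X \<subseteq> {1..n}"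
  shows "n * card {\<pi>. \<pi> permutes {1..n} \<and> \<pi> i \<in> X} = card {\<pi>. \<pi> permutes {1..n::nat}} * card X"
proof -
  let ?P = "\<lambda>j. {\<pi>. \<pi> permutes {1..n} \<and> \<pi> i = j}"
  have fin: "finite {\<pi>. \<pi> permutes {1..n}}" by (rule finite_permutations) simp
  have finP: "finite (?P j)" for j by (rule finite_subset[OF _ fin]) auto
  have le: "card (?P j) \<le> card (?P k)" if jk: "j \<in> {1..n}" "k \<in> {1..n}" for j k
  proof (rule card_inj_on_le[OF _ _ finP])
    show "inj_on (\<lambda>\<pi>. Transposition.transpose j k \<circ> \<pi>) (?P j)"
      by (rule inj_onI) (metis comp_assoc id_comp transpose_comp_involutory)
    show "(\<lambda>\<pi>. Transposition.transpose j k \<circ> \<pi>) ` ?P j \<subseteq> ?P k"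
    proof (rule image_subsetI, rule CollectI, rule conjI)
      fix \<pi> assume "\<pi> \<in> ?P j"
      then show "Transposition.transpose j k \<circ> \<pi> permutes {1..n}" "(Transposition.transpose j k \<circ> \<pi>) i = k"
        using permutes_compose permutes_swap_id[OF jk] by auto
    qed
  qed
  define c where "c = card (?P i)"
  have c: "card (?P j) = c" if "j \<in> {1..n}" for j
    unfolding c_def by (intro le_antisym le that assms(1))
  have sum: "card {\<pi>. \<pi> permutes {1..n} \<and> \<pi> i \<in> Y} = card Y * c" if Y: "Y \<subseteq> {1..n}" for Y
  proof -
    have "{\<pi>. \<pi> permutes {1..n} \<and> \<pi> i \<in> Y} = (\<Union>j\<in>Y. ?P j)" by auto
    moreover have "card (\<Union>j\<in>Y. ?P j) = (\<Sum>j\<in>Y. card (?P j))"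
      using finite_subset[OF Y] finP by (intro card_UN_disjoint) auto
    ultimately show ?thesis using c Y by (simp add: subset_iff)
  qed
  have all: "{\<pi>. \<pi> permutes {1..n} \<and> \<pi> i \<in> {1..n}} = {\<pi>. \<pi> permutes {1..n}}"
    using assms(1) by (auto simp only: permutes_in_image)
  have "card {\<pi>. \<pi> permutes {1..n}} = n * c" using sum[OF order.refl] unfolding all by simp
  then show ?thesis unfolding sum[OF assms(2)] by (simp only: mult_ac)
qed

lemma sum_card_permutes_image_mem_le:
  assumes X: "\<And>i. i < n \<Longrightarrow> X i \<subseteq> {1..n::nat}" "\<And>i. i < n \<Longrightarrow> card (X i) \<le> m" and "1 \<le> n"
  shows "(\<Sum>\<pi> | \<pi> permutes {1..n}. card {i. i < n \<and> \<pi> (Suc i) \<in> X i}) \<le> card {\<pi>. \<pi> permutes {1..n}} * m"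
proof -
  let ?P = "{\<pi>. \<pi> permutes {1..n}}"
  have fin: "finite ?P" by (rule finite_permutations) simp
  have "(\<Sum>\<pi>\<in>?P. card {i. i < n \<and> \<pi> (Suc i) \<in> X i}) = (\<Sum>\<pi>\<in>?P. \<Sum>i<n. of_bool (\<pi> (Suc i) \<in> X i))"
    by (intro sum.cong refl) (simp add: of_bool_def sum.inter_filter[symmetric] lessThan_def)
  also have "\<dots> = (\<Sum>i<n. card {\<pi>. \<pi> permutes {1..n} \<and> \<pi> (Suc i) \<in> X i})"
    using fin by (subst sum.swap) (simp add: of_bool_def sum.inter_filter[symmetric])
  finally have eq: "(\<Sum>\<pi>\<in>?P. card {i. i < n \<and> \<pi> (Suc i) \<in> X i}) =
    (\<Sum>i<n. card {\<pi>. \<pi> permutes {1..n} \<and> \<pi> (Suc i) \<in> X i})" .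
  have "n * (\<Sum>i<n. card {\<pi>. \<pi> permutes {1..n} \<and> \<pi> (Suc i) \<in> X i}) = (\<Sum>i<n. card ?P * card (X i))"
    unfolding sum_distrib_left
    by (rule sum.cong[OF refl], rule card_permutes_image_mem) (use X in auto)
  also have "\<dots> \<le> (\<Sum>i<n. card ?P * m)" using X by (intro sum_mono) simp
  also have "\<dots> = n * (card ?P * m)" by simp
  finally show ?thesis unfolding eq using assms(3) by simp
qed

section \<open>Runs that solve many inputs\<close>

context oblivious_run
begin

definition good :: "(nat \<Rightarrow> nat) \<Rightarrow> (nat \<Rightarrow> nat) set" where
  "good \<pi> = {x \<in> words. permutes_correctly n w B \<pi> (data x) A}"

lemma card_words_pos: "0 < card words"
  using words_finite by (simp add: card_gt_0_iff)

lemma good_subset: "good \<pi> \<subseteq> words"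
  by (auto simp: good_def)

lemma card_good_le: "card (good \<pi>) \<le> card words"
  by (rule card_mono[OF words_finite(1) good_subset])

text \<open>A word of an untouched output block stays zero, so all solved data have a zero in the
  corresponding entry. Setting that entry to 1 maps solved data injectively to unsolved data,
  against the majority of the former.\<close>

lemma ios_ge_output_size:
  assumes \<pi>: "\<pi> permutes {1..n}" and half: "card words < 2 * card (good \<pi>)"
  shows "n \<le> B * t"
proof -
  have "output_block j \<in> accessed p 0 t" if j: "j \<in> {1..n}" for j
  proof (rule ccontr)
    assume na: "output_block j \<notin> accessed p 0 t"
    obtain i where i: "i < n" "\<pi> (Suc i) = j"
    proof -
      have "inv \<pi> j \<in> {1..n}" using permutes_in_image[OF permutes_inv[OF \<pi>]] j by simp
      moreover have "\<pi> (inv \<pi> j) = j" using \<pi> by (rule permutes_inverses)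
      ultimately show thesis using that[of "inv \<pi> j - 1"] by auto
    qed
    have zero: "x i = 0" if x: "x \<in> good \<pi>" for x
    proof -
      let ?D = "input_disk n w B \<pi> (data x)"
      obtain D where D: "halts_with A ?D D" "\<forall>i\<in>{1..n}. output_word n w B D (\<pi> i) = data x i"
        using x by (auto simp: good_def permutes_correctly_def)
      have pat: "access_pattern A ?D = p" by (rule pattern) (use \<pi> in \<open>simp add: valid_input_def\<close>)
      have "D (output_block j) = ?D (output_block j)"
        by (rule em_run_final_unaccessed[of A ?D t]) (use pat halt D na in auto)
      also have "\<dots> = replicate (B * w) False"
        by (rule input_disk_beyond_input) (use w_pos B_pos in \<open>auto simp: output_block_def\<close>)
      finally have "output_word n w B D j = replicate w False"
        by (intro output_word_replicate B_pos) (simp add: output_block_def)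
      then have "binary w (x i) = binary w 0"
        using D(2)[rule_format, of "Suc i"] i by (simp add: data_def binary_0)
      moreover have "x i < 2 ^ w" using x i by (auto simp: good_def PiE_iff)
      ultimately show ?thesis using inj_on_binary[of w] by (auto simp: inj_on_def)
    qed
    have "card (good \<pi>) \<le> card (words - good \<pi>)"
    proof (rule card_inj_on_le)
      show "inj_on (\<lambda>x. x(i := 1)) (good \<pi>)"
        by (rule inj_onI) (metis fun_upd_triv fun_upd_upd zero)
      show "(\<lambda>x. x(i := 1)) ` good \<pi> \<subseteq> words - good \<pi>"
      proof clarify
        fix x assume x: "x \<in> good \<pi>"
        have "(1::nat) < 2 ^ w" using w_pos by (intro one_less_power) auto
        then have "x(i := 1) \<in> words"
          using x i(1) by (auto simp: good_def PiE_iff extensional_def)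
        moreover have "x(i := 1) \<notin> good \<pi>" using zero[of "x(i := 1)"] by auto
        ultimately show "x(i := 1) \<in> words - good \<pi>" by blast
      qed
    qed (use words_finite(1) in simp)
    then show False
      using half words_finite(1) card_Diff_subset[OF finite_subset[OF good_subset words_finite(1)] good_subset, of \<pi>]
      by simp
  qed
  then have "{j \<in> {1..n}. output_block j \<in> accessed p 0 t} = {1..n}" by blast
  then have "n \<le> B * card (accessed p 0 t)"
    using card_vimage_output_block_le[of "accessed p 0 t"] by simp
  also have "\<dots> \<le> B * t" using card_accessed_le[of p 0 t] by simp
  finally show ?thesis .
qed

text \<open>Moving to the nearest solved vector changes at most \<open>sqrt (2 * n)\<close> words on
  average. The corrections thus cost one flag bit per entry plus the changed words, both small
  against \<open>n * w\<close> once \<open>w\<close> and \<open>n\<close> are large.\<close>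

lemma good_network_bound:
  assumes conj: undirected_k_pairs_conjecture
    and \<pi>: "\<pi> permutes {1..n}" and quarter: "card words \<le> 4 * card (good \<pi>)"
  shows "w * (h * card {i. i < n \<and> \<pi> (Suc i) \<notin> near h i}) \<le>
    n * w * h / 2 + (n + w * sqrt (2 * n)) * h + 3 * n * w + t * (B * w) + (t div K) * (M * w)"
proof -
  obtain \<nu> where \<nu>: "\<And>x. \<nu> x \<in> good \<pi>"
    "(\<Sum>x\<in>words. real (card {i \<in> {..<n}. \<nu> x i \<noteq> x i})) \<le> card words * sqrt (2 * card {..<n})"
    by (rule nearest_point_map[of "{..<n}" "{..<2 ^ w}" "good \<pi>"])
      (use quarter good_subset in \<open>auto simp: lessThan_empty_iff\<close>)
  interpret coded_run p K n w B M t A \<pi> \<nu>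
    using \<pi> \<nu>(1) by unfold_locales (auto simp: good_def)
  have "(\<Sum>i<n. correction_rate i) = (\<Sum>i<n. \<Sum>x\<in>words. of_bool (\<nu> x i \<noteq> x i)) / card words"
    using words_finite(1)
    by (simp add: correction_rate_def sum_divide_distrib of_bool_def sum.inter_filter[symmetric])
  also have "(\<Sum>i<n. \<Sum>x\<in>words. of_bool (\<nu> x i \<noteq> x i)) = (\<Sum>x\<in>words. real (card {i \<in> {..<n}. \<nu> x i \<noteq> x i}))"
    by (subst sum.swap) (simp add: of_bool_def sum.inter_filter[symmetric])
  also have "\<dots> / card words \<le> sqrt (2 * n)"
    using \<nu>(2) card_words_pos by (simp add: pos_divide_le_eq mult.commute)
  finally have "(\<Sum>i<n. correction_rate i) * w \<le> sqrt (2 * n) * w" by (rule mult_right_mono) simp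
  moreover have "(\<Sum>i<n. 1 + correction_rate i * w) = n + (\<Sum>i<n. correction_rate i) * w"
    by (simp add: sum.distrib sum_distrib_right)
  ultimately have "(\<Sum>i<n. 1 + correction_rate i * w) \<le> n + w * sqrt (2 * n)"
    by (simp add: mult.commute)
  then have "(\<Sum>i<n. 1 + correction_rate i * w) * h \<le> (n + w * sqrt (2 * n)) * h"
    by (rule mult_right_mono) simp
  then show ?thesis using network_bound[OF conj, of h] by linarith
qed

text \<open>
  A random permutation sends few entries to words near them, because few words are near any given
  entry; hence some permutation is both solved often and has far targets.
\<close>

lemma exists_hard_permutation:
  assumes near: "60 * (B * ((8 * K) ^ h * K)) \<le> n"
    and success: "5 * (card {\<pi>. \<pi> permutes {1..n}} * card words) \<le> 9 * (\<Sum>\<pi> | \<pi> permutes {1..n}. card (good \<pi>))"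
  obtains \<pi> where "\<pi> permutes {1..n}" "card words \<le> 4 * card (good \<pi>)"
    "10 * card {i. i < n \<and> \<pi> (Suc i) \<in> near h i} \<le> n"
proof (rule ccontr)
  let ?P = "{\<pi>. \<pi> permutes {1..n}}"
  let ?bad = "\<lambda>\<pi>. card {i. i < n \<and> \<pi> (Suc i) \<in> near h i}"
  let ?m = "B * ((8 * K) ^ h * K)"
  have fin: "finite ?P" by (rule finite_permutations) simp
  have P0: "0 < card ?P" using fin permutes_id[of "{1..n}"] by (auto simp only: card_gt_0_iff)
  assume none: "\<not> thesis"
  note found = that
  have no: "4 * card (good \<pi>) < card words \<or> n < 10 * ?bad \<pi>" if "\<pi> permutes {1..n}" for \<pi>
  proof (rule ccontr)
    assume "\<not> ?thesis"
    then have thesis using found[of \<pi>] that by simp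
    then show False using none by contradiction
  qed
  \<comment> \<open>Each alternative in \<open>no\<close> is absorbed by one summand. Averaged over
    the permutations, this gives \<open>20 / 9 \<le> 1 + 40 * ?m / n\<close>, while
    \<open>near\<close> leaves at most \<open>5 / 3\<close> on the right.\<close>
  have pt: "4 * n * card (good \<pi>) \<le> n * card words + 40 * ?bad \<pi> * card words" if "\<pi> \<in> ?P" for \<pi>
  proof (cases "4 * card (good \<pi>) < card words")
    case True
    have "4 * n * card (good \<pi>) = n * (4 * card (good \<pi>))" by simp
    also have "\<dots> \<le> n * card words" using True by (intro mult_le_mono2) simp
    finally show ?thesis by (rule trans_le_add1)
  next
    case False
    then have "4 * n * card (good \<pi>) \<le> 4 * (10 * ?bad \<pi>) * card words"
      using no[of \<pi>] that card_good_le[of \<pi>] by (intro mult_le_mono) auto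
    also have "\<dots> = 40 * ?bad \<pi> * card words" by simp
    finally show ?thesis by (rule trans_le_add2)
  qed
  have "4 * n * (\<Sum>\<pi>\<in>?P. card (good \<pi>)) \<le> (\<Sum>\<pi>\<in>?P. n * card words + 40 * ?bad \<pi> * card words)"
    unfolding sum_distrib_left by (rule sum_mono[OF pt])
  also have "\<dots> = card ?P * n * card words + 40 * card words * (\<Sum>\<pi>\<in>?P. ?bad \<pi>)"
    by (simp add: sum.distrib sum_distrib_left mult_ac)
  also have "\<dots> \<le> card ?P * n * card words + 40 * card words * (card ?P * ?m)"
    using n_pos card_near_le[of h]
    by (intro add_left_mono mult_le_mono2 sum_card_permutes_image_mem_le) (auto simp: near_def)
  finally have 1: "4 * n * (\<Sum>\<pi>\<in>?P. card (good \<pi>)) \<le> card ?P * card words * (n + 40 * ?m)"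
    by (simp add: algebra_simps)
  have "4 * n * (5 * (card ?P * card words)) \<le> 4 * n * (9 * (\<Sum>\<pi>\<in>?P. card (good \<pi>)))"
    by (rule mult_le_mono2[OF success])
  also have "\<dots> \<le> 9 * (card ?P * card words * (n + 40 * ?m))"
    using 1 by simp
  finally have "(card ?P * card words) * (20 * n) \<le> (card ?P * card words) * (9 * n + 360 * ?m)"
    by (simp add: algebra_simps)
  then have "20 * n \<le> 9 * n + 360 * ?m" using P0 card_words_pos by simp
  then show False using near n_pos by simp
qed

lemma exists_mostly_solved_permutation:
  assumes success: "5 * (card {\<pi>. \<pi> permutes {1..n}} * card words) \<le> 9 * (\<Sum>\<pi> | \<pi> permutes {1..n}. card (good \<pi>))"
  obtains \<pi> where "\<pi> permutes {1..n}" "card words < 2 * card (good \<pi>)"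
proof (rule ccontr)
  let ?P = "{\<pi>. \<pi> permutes {1..n}}"
  have P0: "0 < card ?P"
    using finite_permutations[of "{1..n}"] permutes_id[of "{1..n}"] by (auto simp only: card_gt_0_iff finite_atLeastAtMost)
  assume no: "\<not> thesis"
  note found = that
  have "2 * card (good \<pi>) \<le> card words" if "\<pi> \<in> ?P" for \<pi>
  proof (rule ccontr)
    assume "\<not> 2 * card (good \<pi>) \<le> card words"
    then have thesis using found[of \<pi>] that by simp
    then show False using no by contradiction
  qed
  then have "2 * (\<Sum>\<pi>\<in>?P. card (good \<pi>)) \<le> card ?P * card words"
    unfolding sum_distrib_left using sum_mono[of ?P "\<lambda>\<pi>. 2 * card (good \<pi>)" "\<lambda>_. card words"] by simp
  then have "10 * (card ?P * card words) \<le> 9 * (card ?P * card words)"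
    using success by linarith
  then show False using P0 card_words_pos by simp
qed

lemma ios_lower_bound:
  assumes conj: undirected_k_pairs_conjecture and K: "K = M div B" and nw: "log 2 n \<le> w"
    and success: "5 * (card {\<pi>. \<pi> permutes {1..n}} * card words) \<le> 9 * (\<Sum>\<pi> | \<pi> permutes {1..n}. card (good \<pi>))"
  shows "1 / 120 * (real n / real B * log (2 * real M / real B) (real n / real B)) \<le> t"
proof -
  define \<beta> where "\<beta> = 2 * real M / real B"
  define L where "L = log \<beta> (n / B)"
  have B: "real B > 0" and n: "real n > 0" and w: "real w > 0" using B_pos n_pos w_pos by auto
  have \<beta>2: "\<beta> \<ge> 2" using B B_le_M by (simp add: \<beta>_def field_simps)
  have "K * B \<le> M" unfolding K by (rule div_times_less_eq_dividend)
  then have "real K * real B \<le> M" by (simp flip: of_nat_mult)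
  then have K\<beta>: "2 * real K \<le> \<beta>" using B by (simp add: \<beta>_def field_simps)
  have MKB: "real M \<le> 2 * real K * real B"
  proof -
    have "M = K * B + M mod B" unfolding K by (simp only: div_mult_mod_eq)
    moreover have "M mod B < B" using B_pos by (intro mod_less_divisor) simp
    ultimately have "M < K * B + B" by linarith
    also have "\<dots> \<le> K * B + K * B" using K_pos by simp
    finally have "M \<le> 2 * K * B" by simp
    then have "real M \<le> real (2 * K * B)" by (simp only: of_nat_le_iff)
    then show ?thesis by simp
  qed
  have trivial: "n / B \<le> t"
  proof -
    obtain \<pi> where "\<pi> permutes {1..n}" "card words < 2 * card (good \<pi>)"
      using exists_mostly_solved_permutation[OF success] .
    then have "n \<le> B * t" by (rule ios_ge_output_size)
    then have "real n \<le> real B * real t" by (simp flip: of_nat_mult)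
    then show ?thesis using B by (simp add: field_simps)
  qed
  \<comment> \<open>For \<open>L \<le> 114\<close> the trivial bound suffices. Beyond, the base
    being at least 2 forces \<open>n \<ge> 2 ^ 114\<close> and so \<open>w \<ge> 114\<close>, which
    makes each correction term at most a hundredth of \<open>n * w * h\<close>.\<close>
  have main: "n / B * L \<le> 120 * real t"
  proof (cases "L \<le> 114")
    case True
    have "n / B * L \<le> n / B * 114" using True n B by (intro mult_left_mono) auto
    also have "\<dots> \<le> real t * 114" by (rule mult_right_mono[OF trivial]) simp
    also have "\<dots> \<le> 120 * real t" by simp
    finally show ?thesis .
  next
    case False
    then have L: "L > 114" by simp
    \<comment> \<open>Chosen such that \<open>3 * h + 9 \<le> L\<close>: with
      \<open>8 * K \<le> \<beta> ^ 3\<close>, \<open>60 \<le> \<beta> ^ 6\<close> and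
      \<open>K \<le> \<beta> ^ 3\<close> the count in \<open>near\<close> stays below
      \<open>\<beta> powr L = n / B\<close>.\<close>
    define h where "h = nat \<lfloor>(L - 9) / 3\<rfloor>"
    have "real h = of_int \<lfloor>(L - 9) / 3\<rfloor>" using L by (simp add: h_def)
    then have "real h \<le> (L - 9) / 3" "(L - 9) / 3 < real h + 1"
      using floor_correct[of "(L - 9) / 3"] by auto
    then have h1: "3 * real h + 9 \<le> L" and h2: "L \<le> 3 * real h + 12" by simp_all
    have nB: "n / B = \<beta> powr L" using \<beta>2 n B by (simp add: L_def)
    have near: "60 * (B * ((8 * K) ^ h * K)) \<le> n"
    proof -
      have "8 * real K \<le> 4 * \<beta>" using K\<beta> by simp
      also have "\<dots> \<le> \<beta> ^ 2 * \<beta>"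
        using \<beta>2 power_mono[of 2 \<beta> 2] by (intro mult_right_mono) auto
      also have "\<dots> = \<beta> ^ 3" by (simp add: power2_eq_square power3_eq_cube)
      finally have 8: "8 * real K \<le> \<beta> ^ 3" .
      have "(60::real) \<le> 2 ^ 6" by simp
      also have "\<dots> \<le> \<beta> ^ 6" using \<beta>2 by (intro power_mono) auto
      finally have 60: "60 \<le> \<beta> ^ 6" .
      have "60 * ((8 * real K) ^ h * K) \<le> \<beta> ^ 6 * ((\<beta> ^ 3) ^ h * \<beta> ^ 3)"
        using 8 60 K_pos \<beta>2 by (intro mult_mono power_mono) auto
      also have "\<dots> = \<beta> ^ (3 * h + 9)" by (simp add: power_mult[symmetric] power_add[symmetric] add.commute)
      also have "\<dots> = \<beta> powr (3 * h + 9)" using \<beta>2 by (subst powr_realpow[symmetric]) auto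
      also have "\<dots> \<le> \<beta> powr L" using h1 \<beta>2 by (intro powr_mono) auto
      finally have "60 * ((8 * real K) ^ h * K) * B \<le> n" using nB B by (simp add: field_simps)
      then have "real (60 * (B * ((8 * K) ^ h * K))) \<le> real n" by (simp add: mult_ac)
      then show ?thesis by (simp only: of_nat_le_iff)
    qed
    obtain \<pi> where \<pi>: "\<pi> permutes {1..n}" "card words \<le> 4 * card (good \<pi>)"
      "10 * card {i. i < n \<and> \<pi> (Suc i) \<in> near h i} \<le> n"
      using exists_hard_permutation[OF near success] .
    have far: "9 / 10 * real n \<le> card {i. i < n \<and> \<pi> (Suc i) \<notin> near h i}"
    proof -
      have "{i. i < n \<and> \<pi> (Suc i) \<notin> near h i} = {..<n} - {i. i < n \<and> \<pi> (Suc i) \<in> near h i}" by auto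
      moreover have "card \<dots> = n - card {i. i < n \<and> \<pi> (Suc i) \<in> near h i}"
        by (subst card_Diff_subset) (auto intro: finite_subset[of _ "{..<n}"])
      ultimately show ?thesis using \<pi>(3) by simp
    qed
    have large: "(2::real) ^ 114 \<le> n" "114 \<le> real w"
    proof -
      have "(2::real) powr 114 \<le> \<beta> powr L"
        using \<beta>2 L by (intro order.trans[OF powr_mono2[of 114 2 \<beta>] powr_mono]) auto
      also have "\<dots> \<le> n" unfolding nB[symmetric] using B_pos n by (simp add: field_simps)
      finally have l: "(2::real) powr 114 \<le> n" .
      then show "(2::real) ^ 114 \<le> n" by (simp add: powr_numeral)
      have "114 \<le> log 2 n" using l n by (simp add: le_log_iff)
      then show "114 \<le> real w" using nw by linarith
    qed
    have sq: "sqrt (2 * n) \<le> n / 100"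
    proof (rule power2_le_imp_le)
      have "20000 * real n \<le> real n * real n" using large(1) n by (intro mult_right_mono) auto
      then show "(sqrt (2 * n))\<^sup>2 \<le> (n / 100)\<^sup>2" by (simp add: power2_eq_square)
    qed simp
    \<comment> \<open>Rounding in \<open>K = M div B\<close> loses at most a factor 2, so the memory
      edges cost at most twice the bound \<open>t * (B * w)\<close> on the block reads.\<close>
    have tK: "(t div K) * (M * w) \<le> 2 * (t * (B * w :: real))"
    proof -
      have "(t div K) * real M \<le> (t div K) * (2 * real K * real B)" by (intro mult_left_mono MKB) simp
      also have "\<dots> = 2 * real ((t div K) * K) * B" by simp
      also have "\<dots> \<le> 2 * real t * B"
        by (intro mult_right_mono mult_left_mono) (simp_all del: of_nat_mult)
      finally have "(t div K) * real M * w \<le> 2 * real t * B * w" by (rule mult_right_mono) simp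
      then show ?thesis by (simp add: mult_ac)
    qed
    have "w * (h * (9 / 10 * real n)) \<le> real w * (real h * card {i. i < n \<and> \<pi> (Suc i) \<notin> near h i})"
      by (intro mult_left_mono far) auto
    also have "\<dots> \<le> n * w * h / 2 + (n + w * sqrt (2 * n)) * h + 3 * n * w + t * (B * w) + (t div K) * (M * w)"
      using good_network_bound[OF conj \<pi>(1,2), of h] by simp
    also have "(n + w * sqrt (2 * n)) * h \<le> (n * (w / 100) + w * (n / 100)) * h"
    proof (intro mult_right_mono add_mono mult_left_mono sq)
      show "real n \<le> n * (w / 100)" using large(2) n by simp
    qed auto
    finally have "w * (h * (9 / 10 * real n)) \<le>
        n * w * h / 2 + (n * (w / 100) + w * (n / 100)) * h + 3 * n * w + t * (B * w) + 2 * (t * (B * w))"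
      using tK by (simp add: mult_ac)
    \<comment> \<open>\<open>38 / 100\<close> is what remains of \<open>9 / 10\<close> after one
      half for the coordinator and two hundredths for the corrections.\<close>
    then have "w * (38 / 100 * (h * n)) \<le> w * (3 * n + 3 * (t * B))"
      by (simp add: algebra_simps)
    then have 1: "38 / 100 * (h * real n) \<le> 3 * real n + 3 * (t * real B)" using w by simp
    have "n * L \<le> n * (3 * real h + 12)" using h2 by (intro mult_left_mono) auto
    also have "\<dots> = 3 * (h * real n) + 12 * real n" by (simp add: distrib_left)
    finally have 2: "n * L \<le> 3 * (h * real n) + 12 * real n" .
    have 3: "real n * 114 \<le> n * L" using L by (intro mult_left_mono) auto
    \<comment> \<open>Since \<open>114 * n \<le> Y\<close>, the terms linear in \<open>n\<close>
      make up less than a third of \<open>Y\<close> and can be absorbed.\<close>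
    have "Y \<le> 120 * Z" if "38 / 100 * X \<le> 3 * real n + 3 * Z" "Y \<le> 3 * X + 12 * real n" "real n * 114 \<le> Y" "0 \<le> Z"
      for X Y Z :: real using that by linarith
    from this[OF 1 2 3] have "n * L \<le> 120 * (t * real B)" by simp
    then have "n * L / B \<le> 120 * real t" by (simp only: pos_divide_le_eq[OF B] mult.assoc)
    then show ?thesis by (simp only: times_divide_eq_left)
  qed
  have "1 / 120 * y \<le> t" if "y \<le> 120 * real t" for y :: real using that by simp
  from this[OF main] show ?thesis unfolding L_def \<beta>_def .
qed

end

text \<open>By obliviousness all valid inputs need the same number of I/Os. Correctness on average
  over permutations and data thus bounds the count on the given input, even if the algorithm fails
  there.\<close>

lemma oblivious_io_count_lower_bound:
  assumes conj: undirected_k_pairs_conjecture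
    and pos: "1 \<le> n" "1 \<le> w" "1 \<le> B" "B \<le> M" and nw: "log 2 (real n) \<le> real w"
    and alg: "em_algorithm (M * w) (B * w) A" and obl: "oblivious_on (permutation_inputs n w B) A"
    and valid: "valid_input n w \<pi>0 d0"
    and success: "9 * card {z \<in> {\<pi>. \<pi> permutes {1..n}} \<times> PiE {..<n} (\<lambda>_. {..<2 ^ w}).
        \<not> permutes_correctly n w B (fst z) (\<lambda>i. binary w (snd z (i - 1))) A}
      \<le> 4 * card ({\<pi>. \<pi> permutes {1..n}} \<times> PiE {..<n} (\<lambda>_. {..<2 ^ w :: nat}))"
  shows "ennreal (1 / 120 * (real n / real B * log (2 * real M / real B) (real n / real B)))
    \<le> io_count A (input_disk n w B \<pi>0 d0)"
proof (cases rule: io_count_cases[of A "input_disk n w B \<pi>0 d0"])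
  case (2 t)
  define p where "p = access_pattern A (input_disk n w B \<pi>0 d0)"
  have K: "1 \<le> M div B" using pos div_le_mono[of B M B] by simp
  interpret oblivious_run p "M div B" n w B M t A
  proof
    show "access_pattern A (input_disk n w B \<pi> d) = p" if "valid_input n w \<pi> d" for \<pi> d
      using obl that valid unfolding oblivious_on_def permutation_inputs_def p_def by blast
  qed (use pos K alg 2 lg_ceil_le[OF nw] in \<open>simp_all add: p_def\<close>)
  let ?P = "{\<pi>. \<pi> permutes {1..n}}"
  have fin: "finite ?P" by (rule finite_permutations) simp
  let ?bad = "{z \<in> ?P \<times> words. \<not> permutes_correctly n w B (fst z) (\<lambda>i. binary w (snd z (i - 1))) A}"
  have eq: "?P \<times> words - ?bad = (SIGMA \<pi>:?P. good \<pi>)"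
  proof (rule set_eqI)
    fix z
    have "data x = (\<lambda>i. binary w (x (i - 1)))" for x by (simp add: data_def fun_eq_iff)
    then show "z \<in> ?P \<times> words - ?bad \<longleftrightarrow> z \<in> (SIGMA \<pi>:?P. good \<pi>)"
      by (cases z) (simp only: good_def mem_Sigma_iff mem_Collect_eq Diff_iff fst_conv snd_conv, blast)
  qed
  have "card ?bad + card (SIGMA \<pi>:?P. good \<pi>) = card (?P \<times> words)"
  proof -
    have finT: "finite (?P \<times> words)" using fin words_finite(1) by (rule finite_cartesian_product)
    have sub: "?bad \<subseteq> ?P \<times> words" by (rule Collect_restrict)
    show ?thesis
      unfolding eq[symmetric] card_Diff_subset[OF finite_subset[OF sub finT] sub]
      by (rule le_add_diff_inverse[OF card_mono[OF finT sub]])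
  qed
  moreover have "card (SIGMA \<pi>:?P. good \<pi>) = (\<Sum>\<pi>\<in>?P. card (good \<pi>))"
    using fin finite_subset[OF good_subset words_finite(1)] by (intro card_SigmaI) auto
  ultimately have "5 * (card ?P * card words) \<le> 9 * (\<Sum>\<pi>\<in>?P. card (good \<pi>))"
    using success by (simp add: card_cartesian_product)
  from ios_lower_bound[OF conj refl nw this] show ?thesis by (simp add: 2 ennreal_leI)
qed simp

theorem theorem5:
  assumes "undirected_k_pairs_conjecture"
  shows "\<exists>c>0. \<forall>(n::nat) (w::nat) (B::nat) (M::nat) (R :: em_alg measure).
    1 \<le> n \<longrightarrow> 1 \<le> w \<longrightarrow> log 2 (real n) \<le> real w \<longrightarrow> 1 \<le> B \<longrightarrow> B \<le> M \<longrightarrow>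
    oblivious_randomized_permutation_alg n w B M (1 / 3) R \<longrightarrow>
    (\<forall>\<pi> d. valid_input n w \<pi> d \<longrightarrow>
      ennreal (c * (real n / real B * log (2 * real M / real B) (real n / real B)))
        \<le> (\<integral>\<^sup>+ A. io_count A (input_disk n w B \<pi> d) \<partial>R))"
proof (intro exI[of _ "1 / 480"] conjI allI impI)
  fix n w B M :: nat and R :: "em_alg measure" and \<pi>0 :: "nat \<Rightarrow> nat" and d0 :: "nat \<Rightarrow> bits"
  assume pos: "1 \<le> n" "1 \<le> w" "1 \<le> B" "B \<le> M" and nw: "log 2 (real n) \<le> real w"
    and R: "oblivious_randomized_permutation_alg n w B M (1 / 3) R"
    and valid: "valid_input n w \<pi>0 d0"
  interpret prob_space R using R by (simp add: oblivious_randomized_permutation_alg_def)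
  have alg: "em_algorithm (M * w) (B * w) A" "oblivious_on (permutation_inputs n w B) A"
    if "A \<in> space R" for A
    using R that by (auto simp: oblivious_randomized_permutation_alg_def)
  define b where "b = real n / real B * log (2 * real M / real B) (real n / real B)"
  define I where "I = {\<pi>. \<pi> permutes {1..n}} \<times> PiE {..<n} (\<lambda>_. {..<2 ^ w :: nat})"
  define fails where "fails \<pi> x A \<longleftrightarrow> \<not> permutes_correctly n w B \<pi> (\<lambda>i. binary w (x (i - 1))) A"
    for \<pi> x A
  define err where "err A = card {z \<in> I. fails (fst z) (snd z) A}" for A
  have fin: "finite I" unfolding I_def
    by (intro finite_cartesian_product finite_permutations finite_PiE) auto
  have "(id, \<lambda>i\<in>{..<n}. 0) \<in> I" using permutes_id by (auto simp: I_def)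
  then have I0: "0 < card I" using fin by (auto simp: card_gt_0_iff)
  have meas: "{A \<in> space R. fails \<pi> x A} \<in> sets R" "prob {A \<in> space R. fails \<pi> x A} \<le> 1 / 3"
    if "(\<pi>, x) \<in> I" for \<pi> x
  proof -
    have "valid_input n w \<pi> (\<lambda>i. binary w (x (i - 1)))" using that by (simp add: valid_input_def I_def)
    then show "{A \<in> space R. fails \<pi> x A} \<in> sets R" "prob {A \<in> space R. fails \<pi> x A} \<le> 1 / 3"
      using R unfolding oblivious_randomized_permutation_alg_def fails_def by blast+
  qed
  have err_sum: "real (err A) = (\<Sum>(\<pi>, x)\<in>I. indicator {A \<in> space R. fails \<pi> x A} A)"
    if "A \<in> space R" for A
  proof -
    have "real (err A) = (\<Sum>z\<in>I. of_bool (fails (fst z) (snd z) A))"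
      unfolding err_def using fin by (simp add: of_bool_def sum.inter_filter[symmetric])
    also have "\<dots> = (\<Sum>(\<pi>, x)\<in>I. indicator {A \<in> space R. fails \<pi> x A} A)"
      using that by (intro sum.cong refl) (auto simp: indicator_def)
    finally show ?thesis .
  qed
  \<comment> \<open>Markov's inequality: the mean failing fraction is at most \<open>1 / 3\<close>,
    so it exceeds \<open>4 / 9\<close> with probability at most \<open>3 / 4\<close>. The threshold
    lies below one half, leaving a majority of solved pairs.\<close>
  define Z where "Z = {A \<in> space R. 4 * card I < 9 * err A}"
  have int: "integrable R (\<lambda>A. \<Sum>(\<pi>, x)\<in>I. indicator {A \<in> space R. fails \<pi> x A} A :: real)"
    using meas by (intro Bochner_Integration.integrable_sum) (auto simp: emeasure_eq_measure)
  have Z: "Z \<in> sets R"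
  proof -
    have "Z = {A \<in> space R. 4 * real (card I) < 9 * (\<Sum>(\<pi>, x)\<in>I. indicator {A \<in> space R. fails \<pi> x A} A)}"
      unfolding Z_def by (rule Collect_cong) (auto simp flip: err_sum)
    also have "\<dots> \<in> sets R"
      using borel_measurable_integrable[OF int] by measurable
    finally show ?thesis .
  qed
  have "4 / 9 * card I * prob Z = (\<integral>A. 4 / 9 * card I * indicator Z A \<partial>R)"
    using Z by simp
  also have "\<dots> \<le> (\<integral>A. (\<Sum>(\<pi>, x)\<in>I. indicator {A \<in> space R. fails \<pi> x A} A) \<partial>R)"
  proof (rule integral_mono[OF _ int])
    show "integrable R (\<lambda>A. 4 / 9 * card I * indicator Z A)"
      using Z by (auto simp: emeasure_eq_measure)
    show "4 / 9 * card I * indicator Z A \<le> (\<Sum>(\<pi>, x)\<in>I. indicator {A \<in> space R. fails \<pi> x A} A :: real)"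
      if "A \<in> space R" for A
      using that unfolding err_sum[OF that, symmetric] by (auto simp: Z_def indicator_def)
  qed
  also have "\<dots> = (\<Sum>(\<pi>, x)\<in>I. prob {A \<in> space R. fails \<pi> x A})"
    using meas by (subst Bochner_Integration.integral_sum)
      (auto simp: emeasure_eq_measure split_beta intro!: sum.cong)
  also have "\<dots> \<le> (\<Sum>z\<in>I. 1 / 3)" using meas by (intro sum_mono) auto
  finally have "prob Z \<le> 3 / 4" using I0 by simp
  then have quarter: "1 / 4 \<le> prob (space R - Z)" using prob_compl[OF Z] by simp
  have low: "ennreal (1 / 120 * b) * indicator (space R - Z) A \<le> io_count A (input_disk n w B \<pi>0 d0)"
    if A: "A \<in> space R" for A
  proof (cases "A \<in> Z")
    case False
    then have "9 * err A \<le> 4 * card I" using A by (simp add: Z_def)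
    then have "ennreal (1 / 120 * b) \<le> io_count A (input_disk n w B \<pi>0 d0)"
      unfolding b_def err_def I_def fails_def
      by (intro oblivious_io_count_lower_bound[OF assms pos nw alg[OF A] valid])
    then show ?thesis using A False by simp
  qed simp
  \<comment> \<open>The factor \<open>1 / 4\<close> is the probability of the random choices outside
    \<open>Z\<close>. For \<open>n < B\<close> the number \<open>b\<close> is negative and
    \<open>ennreal\<close> turns the bound into 0.\<close>
  have "ennreal (1 / 480 * b) \<le> ennreal (1 / 120 * b) * ennreal (1 / 4)"
    by (cases "0 \<le> b") (simp_all add: ennreal_mult[symmetric] ennreal_neg)
  also have "\<dots> \<le> ennreal (1 / 120 * b) * emeasure R (space R - Z)"
    unfolding emeasure_eq_measure by (intro mult_left_mono ennreal_leI quarter) auto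
  also have "\<dots> = (\<integral>\<^sup>+ A. ennreal (1 / 120 * b) * indicator (space R - Z) A \<partial>R)"
    using Z by (intro nn_integral_cmult_indicator[symmetric]) auto
  also have "\<dots> \<le> (\<integral>\<^sup>+ A. io_count A (input_disk n w B \<pi>0 d0) \<partial>R)"
    by (rule nn_integral_mono[OF low])
  finally show "ennreal (1 / 480 * (real n / real B * log (2 * real M / real B) (real n / real B)))
      \<le> (\<integral>\<^sup>+ A. io_count A (input_disk n w B \<pi>0 d0) \<partial>R)"
    by (simp add: b_def)
qed simp

end
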